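(* Let $A:[0,\infty)\to\mathbb{R}^{d\times d}$ be bounded and globally Lipschitz continuous, and assume that the system $\dot x=A(t)x$ is regular and has stable Lyapunov exponents. Let $\Phi$ be a one-step method for this system that is consistent of order $p>0$, and let $(h_n)_{n\ge1}$ be stepsizes with $0<h_n\le h_{\max}$ and $t_n=h_1+\dots+h_n\to\infty$. If $h_n\to0$, then for Lebesgue-almost every tuple of initial vectors $(v_1,\dots,v_d)\in(\mathbb{R}^d)^d$ the outputs $\mu_i(n)$ of Benettin's algorithm satisfy $$\lim_{n\to\infty}\mu_i(n)=\Lambda_i$$ for all $i=1,\dots,d$.
   Context: Norms are Euclidean norms and associated operator norms. $X(t)$ denotes a fundamental matrix of $\dot x=A(t)x$ and $X(t,s)=X(t)X(s)^{-1}$ the Cauchy matrix. Lyapunov exponents: for a solution $x$ put $\chi[x]=\limsup_{t\to\infty}\frac1t\log\|x(t)\|$. The distinct values of $\chi$ on non-trivial solutions are $\lambda_1>\dots>\lambda_q$; with $V_i=\{x \text{ solution}:\chi[x]\le\lambda_i\}$, $V_{q+1}=\{0\}$, the multiplicity of $\lambda_i$ is $d_i=\dim V_i-\dim V_{i+1}$. Counted with multiplicity: $\Lambda_1\ge\dots\ge\Lambda_d$ (each $\lambda_i$ repeated $d_i$ times). The system is regular if $\sum_{i=1}^d\Lambda_i=\liminf_{t\to\infty}\frac1t\log|\det X(t)|$. Stable Lyapunov exponents: for every $\epsilon>0$ there is $\delta>0$ such that for every continuous $Q:[0,\infty)\to\mathbb{R}^{d\times d}$ with $\sup_{t\ge0}\|Q(t)\|<\delta$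 the Lyapunov exponents $\tilde\Lambda_1\ge\dots\ge\tilde\Lambda_d$ of $\dot{\tilde x}=(A(t)+Q(t))\tilde x$ satisfy $|\Lambda_i-\tilde\Lambda_i|<\epsilon$ for $i=1,\dots,d$. One-step method: fix $0<h_{\max}<\infty$. A (linear) one-step method is a map $\Phi:[0,\infty)\times[0,h_{\max}]\to GL(d,\mathbb{R})$. It is consistent of order $p>0$ if there is a constant $c_\Phi>0$ with $\|\Phi(t,h)-X(t+h,t)\|\le c_\Phi h^{p+1}$ for all $t\ge0$, $0\le h\le h_{\max}$. Given stepsizes, put $t_0=0$, $t_n=h_1+\dots+h_n$, $\Phi_n=\Phi(t_{n-1},h_n)$. Benettin's algorithm: start with $V_0=[v_1,\dots,v_d]$ (invertible for almost every tuple). For $n\ge1$ compute the QR-decomposition $\Phi_nV_{n-1}=Q_nR_n$ ($Q_n$ orthogonal, $R_n$ upper triangular with positive diagonal) and set $V_n=Q_n$. The output after $n$ steps is $\mu_i(n)=\frac1{t_n}\sum_{k=1}^n\log (R_k)_{ii}$, $i=1,\dots,d$. *)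

theory Defs
  imports "HOL-Analysis.Analysis" "HOL-Library.Function_Algebras"
begin

text \<open>
  Systems \<open>x' = A(t) x\<close> on \<open>[0, \<infinity>)\<close> in dimension \<open>d = CARD('n)\<close>. All functions of time have
  type \<open>real \<Rightarrow> _\<close>, and only their values at \<open>t \<ge> 0\<close> matter. The linear order on the index
  type \<open>'n\<close> plays the role of the order on \<open>{1, \<dots>, d}\<close>.
\<close>

type_synonym 'n sqmat = "real^'n^'n"

text \<open>
  The library norm on \<open>real^'n^'n\<close> is the Frobenius norm, so the operator norm is introduced
  separately.
\<close>

definition opnorm :: "real^'n^'m \<Rightarrow> real" where
  "opnorm M = onorm ((*v) M)"


subsection \<open>Linear systems\<close>

text \<open>
  Setting a solution to \<open>0\<close> at negative times makes the set of solutions on \<open>[0, \<infinity>)\<close> a genuine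
  vector space of functions on the reals.
\<close>

definition solution :: "(real \<Rightarrow> 'n sqmat) \<Rightarrow> (real \<Rightarrow> real^'n) \<Rightarrow> bool" where
  "solution A x \<longleftrightarrow>
     (\<forall>t\<ge>0. (x has_vector_derivative A t *v x t) (at t within {0..})) \<and> (\<forall>t<0. x t = 0)"

definition fundamental_matrix ::
    "(real \<Rightarrow> ('n::finite) sqmat) \<Rightarrow> (real \<Rightarrow> 'n sqmat) \<Rightarrow> bool" where
  "fundamental_matrix A X \<longleftrightarrow>
     (\<forall>t\<ge>0. (X has_vector_derivative A t ** X t) (at t within {0..}) \<and> invertible (X t))"

definition cauchy_matrix :: "(real \<Rightarrow> ('n::finite) sqmat) \<Rightarrow> real \<Rightarrow> real \<Rightarrow> 'n sqmat" where
  "cauchy_matrix X t s = X t ** matrix_inv (X s)"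


subsection \<open>Lyapunov exponents\<close>

text \<open>Natural logarithm with \<open>log 0 = -\<infinity>\<close> (whereas \<open>ln 0 = 0\<close> in the library).\<close>

definition elog :: "real \<Rightarrow> ereal" where
  "elog r = (if r \<le> 0 then -\<infinity> else ereal (ln r))"

definition lyap_exp :: "(real \<Rightarrow> real^'n) \<Rightarrow> ereal" where
  "lyap_exp x = Limsup at_top (\<lambda>t. ereal (1 / t) * elog (norm (x t)))"

definition lyap_values :: "(real \<Rightarrow> ('n::finite) sqmat) \<Rightarrow> ereal set" where
  "lyap_values A = {lyap_exp x | x. solution A x \<and> x \<noteq> (\<lambda>_. 0)}"

text \<open>
  \<open>\<lambda>\<^sub>1 > \<dots> > \<lambda>\<^sub>q\<close>, indexed from \<open>0\<close>. The set of values is finite for every continuous \<open>A\<close>.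
\<close>

definition lyap_distinct :: "(real \<Rightarrow> ('n::finite) sqmat) \<Rightarrow> ereal list" where
  "lyap_distinct A = rev (sorted_list_of_set (lyap_values A))"

definition lyap_space :: "(real \<Rightarrow> 'n sqmat) \<Rightarrow> nat \<Rightarrow> (real \<Rightarrow> real^'n) set" where
  "lyap_space A i =
     (if i < length (lyap_distinct A) then {x. solution A x \<and> lyap_exp x \<le> lyap_distinct A ! i}
      else {\<lambda>_. 0})"

abbreviation fun_scale :: "real \<Rightarrow> (real \<Rightarrow> real^'n) \<Rightarrow> real \<Rightarrow> real^'n" where
  "fun_scale c x \<equiv> (\<lambda>t. c *\<^sub>R x t)"

text \<open>
  Functions are not an instance of \<open>real_vector\<close>; the dimension of a space of solutions is the
  library dimension for pointwise addition and scaling.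
\<close>

lemma vector_space_fun_scale: "vector_space (fun_scale :: _ \<Rightarrow> (real \<Rightarrow> real^'n) \<Rightarrow> _)"
  by unfold_locales (auto simp: fun_eq_iff algebra_simps)

definition lyap_mult :: "(real \<Rightarrow> ('n::finite) sqmat) \<Rightarrow> nat \<Rightarrow> nat" where
  "lyap_mult A i =
     vector_space.dim fun_scale (lyap_space A i) - vector_space.dim fun_scale (lyap_space A (Suc i))"

definition lyap_spectrum :: "(real \<Rightarrow> ('n::finite) sqmat) \<Rightarrow> ereal list" where
  "lyap_spectrum A =
     concat (map (\<lambda>i. replicate (lyap_mult A i) (lyap_distinct A ! i))
                 [0..<length (lyap_distinct A)])"

text \<open>\<open>\<Lambda>\<^sub>i\<close>: if \<open>i\<close> is the \<open>k\<close>-th smallest index, then the \<open>k\<close>-th entry of the spectrum.\<close>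

definition Lyap :: "(real \<Rightarrow> 'n sqmat) \<Rightarrow> 'n::{finite,linorder} \<Rightarrow> ereal" where
  "Lyap A i = lyap_spectrum A ! card {j. j < i}"

definition regular_system ::
    "(real \<Rightarrow> 'n sqmat) \<Rightarrow> (real \<Rightarrow> ('n::{finite,linorder}) sqmat) \<Rightarrow> bool" where
  "regular_system A X \<longleftrightarrow>
     (\<Sum>i\<in>UNIV. Lyap A i) = Liminf at_top (\<lambda>t. ereal (1 / t) * elog \<bar>det (X t)\<bar>)"

definition stable_exponents :: "(real \<Rightarrow> ('n::{finite,linorder}) sqmat) \<Rightarrow> bool" where
  "stable_exponents A \<longleftrightarrow>
     (\<forall>\<epsilon>>0::real. \<exists>\<delta>>0::real. \<forall>Q :: real \<Rightarrow> 'n sqmat.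
        continuous_on {0..} Q \<longrightarrow> (SUP t\<in>{0..}. ereal (opnorm (Q t))) < ereal \<delta> \<longrightarrow>
        (\<forall>i. \<bar>Lyap A i - Lyap (\<lambda>t. A t + Q t) i\<bar> < ereal \<epsilon>))"


subsection \<open>One-step methods\<close>

definition one_step_method :: "real \<Rightarrow> (real \<Rightarrow> real \<Rightarrow> ('n::finite) sqmat) \<Rightarrow> bool" where
  "one_step_method hmax \<Phi> \<longleftrightarrow> (\<forall>t\<ge>0. \<forall>h\<in>{0..hmax}. invertible (\<Phi> t h))"

definition consistent ::
    "(real \<Rightarrow> ('n::finite) sqmat) \<Rightarrow> real \<Rightarrow> (real \<Rightarrow> real \<Rightarrow> 'n sqmat) \<Rightarrow> real \<Rightarrow> bool" where
  "consistent X hmax \<Phi> p \<longleftrightarrow>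
     (\<exists>c>0. \<forall>t\<ge>0. \<forall>h\<in>{0..hmax}.
        opnorm (\<Phi> t h - cauchy_matrix X (t + h) t) \<le> c * h powr (p + 1))"

text \<open>Stepsizes are \<open>h 1, h 2, \<dots>\<close>; the value \<open>h 0\<close> is never used.\<close>

definition grid :: "(nat \<Rightarrow> real) \<Rightarrow> nat \<Rightarrow> real" where
  "grid h n = (\<Sum>k=1..n. h k)"

definition step_matrix ::
    "(real \<Rightarrow> real \<Rightarrow> ('n::finite) sqmat) \<Rightarrow> (nat \<Rightarrow> real) \<Rightarrow> nat \<Rightarrow> 'n sqmat" where
  "step_matrix \<Phi> h n = \<Phi> (grid h (n - 1)) (h n)"


subsection \<open>Benettin's algorithm\<close>

definition is_QR ::
    "'n sqmat \<Rightarrow> 'n sqmat \<Rightarrow> ('n::{finite,linorder}) sqmat \<Rightarrow> bool" where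
  "is_QR M Q R \<longleftrightarrow>
     M = Q ** R \<and> orthogonal_matrix Q \<and> (\<forall>i j. j < i \<longrightarrow> R $ i $ j = 0) \<and> (\<forall>i. 0 < R $ i $ i)"

text \<open>For invertible \<open>M\<close> the decomposition exists and is unique; otherwise the value is unspecified.\<close>

definition qr :: "('n::{finite,linorder}) sqmat \<Rightarrow> ('n sqmat) \<times> ('n sqmat)" where
  "qr M = (SOME (Q, R). is_QR M Q R)"

text \<open>
  A tuple \<open>(v\<^sub>1, \<dots>, v\<^sub>d)\<close> is represented by \<open>v :: 'n sqmat\<close> with \<open>v $ i\<close> the \<open>i\<close>-th vector;
  the matrix having these vectors as columns is \<open>transpose v\<close>.
\<close>

primrec benettin_V ::
    "(real \<Rightarrow> real \<Rightarrow> 'n sqmat) \<Rightarrow> (nat \<Rightarrow> real) \<Rightarrow> 'n sqmat \<Rightarrow> nat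
       \<Rightarrow> ('n::{finite,linorder}) sqmat" where
  "benettin_V \<Phi> h v 0 = transpose v"
| "benettin_V \<Phi> h v (Suc n) = fst (qr (step_matrix \<Phi> h (Suc n) ** benettin_V \<Phi> h v n))"

text \<open>\<open>R\<^sub>n\<close>, meaningful for \<open>n \<ge> 1\<close>.\<close>

definition benettin_R ::
    "(real \<Rightarrow> real \<Rightarrow> 'n sqmat) \<Rightarrow> (nat \<Rightarrow> real) \<Rightarrow> 'n sqmat \<Rightarrow> nat
       \<Rightarrow> ('n::{finite,linorder}) sqmat" where
  "benettin_R \<Phi> h v n = snd (qr (step_matrix \<Phi> h n ** benettin_V \<Phi> h v (n - 1)))"

definition benettin_output ::
    "(real \<Rightarrow> real \<Rightarrow> 'n sqmat) \<Rightarrow> (nat \<Rightarrow> real) \<Rightarrow> 'n sqmat \<Rightarrow> 'n::{finite,linorder}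
       \<Rightarrow> nat \<Rightarrow> real" where
  "benettin_output \<Phi> h v i n = (1 / grid h n) * (\<Sum>k=1..n. ln (benettin_R \<Phi> h v k $ i $ i))"

end

theory Submission
  imports Defs
begin

text \<open>
  Let \<open>Y\<^sub>n\<close> be the product of the first \<open>n\<close> step matrices. If \<open>Y\<^sub>n V\<^sub>0 = Q\<^sub>n S\<^sub>n\<close> is the
  QR-decomposition, then \<open>exp (t\<^sub>n \<mu>\<^sub>i(n))\<close> is the \<open>i\<close>-th diagonal entry of \<open>S\<^sub>n\<close>, hence at most
  \<open>\<parallel>Y\<^sub>n u\<parallel>\<close> for every \<open>u\<close> in \<open>v\<^sub>i + span {v\<^sub>j | j < i}\<close>. For almost every tuple this affine space meets
  any given subspace of codimension at most \<open>i - 1\<close>.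

  The steps are solutions at the times \<open>t\<^sub>n\<close> of a perturbed system: interpolating
  \<open>X(t\<^sub>n)\<^sup>-\<^sup>1 Y\<^sub>n\<close> smoothly by \<open>M(t)\<close>, the product \<open>Z = X M\<close> solves
  \<open>Z' = (A + X M' Z\<^sup>-\<^sup>1) Z\<close>, and the perturbation is \<open>O(h\<^sub>n\<^sup>p)\<close>. If the steps are replaced by exact
  ones up to a large time, it is smaller than any given \<open>\<delta>\<close> and stability provides the subspace of
  codimension at most \<open>i - 1\<close> on which \<open>Y\<^sub>n\<close> grows at most at rate \<open>\<Lambda>\<^sub>i + \<epsilon>\<close>. So
  \<open>limsup \<mu>\<^sub>i(n) \<le> \<Lambda>\<^sub>i\<close> for every \<open>i\<close>.

  Conversely \<open>t\<^sub>n (\<mu>\<^sub>1(n) + \<dots> + \<mu>\<^sub>d(n)) = log \<bar>det (Y\<^sub>n V\<^sub>0)\<bar>\<close>, which differs from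
  \<open>log \<bar>det X(t\<^sub>n)\<bar>\<close> by \<open>o(t\<^sub>n)\<close>, so regularity bounds the lower limit of the sum of the \<open>\<mu>\<^sub>i\<close>
  from below by the sum of the \<open>\<Lambda>\<^sub>i\<close>. The two bounds force convergence.
\<close>

section \<open>Matrices and QR-decompositions\<close>

lemma norm_le_opnorm: "norm (M *v x) \<le> opnorm M * norm x"
  unfolding opnorm_def by (rule onorm[OF matrix_vector_mul_bounded_linear])

lemma opnorm_le:
  assumes "\<And>x. norm (M *v x) \<le> b * norm x"
  shows "opnorm M \<le> b"
  unfolding opnorm_def by (rule onorm_le) (use assms in auto)

lemma matrix_inv_mult:
  fixes M :: "('n::finite) sqmat"
  assumes "invertible M"
  shows "M ** matrix_inv M = mat 1" "matrix_inv M ** M = mat 1"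
  using someI_ex[OF assms[unfolded invertible_def]] unfolding matrix_inv_def by auto

lemma invertible_iff_kernel:
  fixes M :: "('n::finite) sqmat"
  shows "invertible M \<longleftrightarrow> (\<forall>x. M *v x = 0 \<longrightarrow> x = 0)"
  using invertible_left_inverse[of M] matrix_left_invertible_ker[of M] by blast

section \<open>Triangular determinants and Gram-Schmidt orthogonalization\<close>

lemma permutes_increasing_id:
  fixes p :: "'n::{finite,linorder} \<Rightarrow> 'n"
  assumes "inj p" "\<And>i. i \<le> p i"
  shows "p = id"
proof (rule ccontr)
  assume "p \<noteq> id"
  then have ne: "{i. p i \<noteq> i} \<noteq> {}" by auto
  \<comment> \<open>The largest moved index goes to a larger one, which is fixed; injectivity
    forbids this.\<close>
  define i where "i = Max {i. p i \<noteq> i}"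
  have i: "p i \<noteq> i" using Max_in[OF _ ne] by (auto simp: i_def)
  have "p (p i) = p i"
  proof (rule ccontr)
    assume "p (p i) \<noteq> p i"
    then have "p i \<le> i" unfolding i_def by (intro Max_ge) auto
    with assms(2)[of i] i show False by simp
  qed
  with i \<open>inj p\<close> show False by (auto dest: injD)
qed

text \<open>Every permutation other than the identity sends some index below itself, so its term
  contains an entry below the diagonal and vanishes.\<close>

lemma det_upper_triangular:
  fixes S :: "('n::{finite,linorder}) sqmat"
  assumes "\<And>i j. j < i \<Longrightarrow> S $ i $ j = 0"
  shows "det S = (\<Prod>i\<in>UNIV. S $ i $ i)"
proof -
  have "(\<Prod>i\<in>UNIV. S $ i $ p i) = 0" if "p permutes UNIV" "p \<noteq> id" for p
  proof -
    from that permutes_increasing_id[of p] obtain i where "p i < i"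
      by (auto simp: permutes_inj not_le[symmetric])
    then show ?thesis using assms by (intro prod_zero) auto
  qed
  then have "det S = (\<Sum>p\<in>{id}. of_int (sign p) * (\<Prod>i\<in>UNIV. S $ i $ p i))"
    unfolding det_def
    by (intro sum.mono_neutral_right) (auto simp: permutes_id finite_permutations)
  then show ?thesis by simp
qed

text \<open>Vectors are orthonormalized in increasing order of index. Stating the result for subsets
  \<open>J\<close> lets the induction add the largest index last, while independence stays a
  hypothesis on the whole family.\<close>

lemma gram_schmidt:
  fixes m :: "'n::{finite,linorder} \<Rightarrow> real^'k"
  assumes indep: "\<And>c. (\<Sum>j\<in>UNIV. c j *\<^sub>R m j) = 0 \<Longrightarrow> \<forall>j. c j = 0"
  shows "\<exists>q r. (\<forall>i\<in>J. \<forall>j\<in>J. q i \<bullet> q j = (if i = j then 1 else 0)) \<and>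
     (\<forall>j\<in>J. m j = (\<Sum>i\<in>J. r i j *\<^sub>R q i) \<and> 0 < r j j \<and> (\<forall>i\<in>J. j < i \<longrightarrow> r i j = (0::real)))"
proof -
  have "finite J" by simp
  \<comment> \<open>The extra conjunct confines \<open>q\<close> to the span of the vectors treated
    so far; this is what makes the next residual nonzero.\<close>
  then have "\<exists>q r. (\<forall>i\<in>J. \<forall>j\<in>J. q i \<bullet> q j = (if i = j then 1 else 0)) \<and>
     (\<forall>j\<in>J. m j = (\<Sum>i\<in>J. r i j *\<^sub>R q i) \<and> 0 < r j j \<and> (\<forall>i\<in>J. j < i \<longrightarrow> r i j = (0::real))) \<and>
     q ` J \<subseteq> span (m ` J)"
  proof (induction rule: finite_linorder_max_induct)
    case empty
    show ?case by simp
  next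
    case (insert b J)
    from insert.IH obtain q r where
      orth': "\<forall>i\<in>J. \<forall>j\<in>J. q i \<bullet> q j = (if i = j then 1 else 0)"
      and exp': "\<forall>j\<in>J. m j = (\<Sum>i\<in>J. r i j *\<^sub>R q i) \<and> 0 < r j j \<and>
        (\<forall>i\<in>J. j < i \<longrightarrow> r i j = 0)"
      and sp: "q ` J \<subseteq> span (m ` J)" by blast
    have orth: "q i \<bullet> q j = (if i = j then 1 else 0)" if "i \<in> J" "j \<in> J" for i j
      using orth' that by blast
    have exp: "m j = (\<Sum>i\<in>J. r i j *\<^sub>R q i)" and pos: "0 < r j j" if "j \<in> J" for j
      using exp' that by blast+
    have tri: "r i j = 0" if "i \<in> J" "j \<in> J" "j < i" for i j
      using exp' that by blast
    have b: "b \<notin> J" using insert.hyps(2) by auto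
    define u where "u = m b - (\<Sum>i\<in>J. (q i \<bullet> m b) *\<^sub>R q i)"
    have psp: "(\<Sum>i\<in>J. (q i \<bullet> m b) *\<^sub>R q i) \<in> span (m ` J)"
      using sp by (intro span_sum span_scale) auto
    have "u \<noteq> 0"
    proof
      assume "u = 0"
      with psp have "m b \<in> span (m ` J)" by (simp add: u_def)
      \<comment> \<open>Injectivity lets a combination over the image set be rewritten over indices.
        Equal vectors at \<open>x \<noteq> y\<close> would give a vanishing combination with
        coefficients 1 and -1.\<close>
      moreover have "inj_on m J"
      proof (rule inj_onI, rule ccontr)
        fix x y assume "m x = m y" "x \<noteq> y"
        have "(\<Sum>j\<in>UNIV. ((if j = x then 1 else 0) + (if j = y then -1 else 0::real)) *\<^sub>R m j) = m x - m y"
          by (simp add: scaleR_add_left sum.distrib if_distrib[of "\<lambda>c. c *\<^sub>R _"] cong: if_cong)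
        then have "\<forall>j. (if j = x then 1 else 0) + (if j = y then -1 else 0::real) = 0"
          using \<open>m x = m y\<close> by (intro indep) simp
        from spec[OF this, of x] \<open>x \<noteq> y\<close> show False by simp
      qed
      moreover obtain f where "m b = (\<Sum>v\<in>m ` J. f v *\<^sub>R v)"
        using \<open>m b \<in> span (m ` J)\<close> by (auto simp: span_finite)
      ultimately obtain c where "m b = (\<Sum>i\<in>J. c i *\<^sub>R m i)"
        by (simp add: sum.reindex)
      \<comment> \<open>Solving for \<open>m b\<close> gives a vanishing combination whose
        coefficient at \<open>b\<close> is 1.\<close>
      moreover have "(\<Sum>j\<in>UNIV. (if j = b then 1 else if j \<in> J then - c j else 0) *\<^sub>R m j)
          = (\<Sum>j\<in>insert b J. (if j = b then 1 else - c j) *\<^sub>R m j)"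
        by (intro sum.mono_neutral_cong_right) auto
      moreover have "\<dots> = m b + (\<Sum>j\<in>J. (if j = b then 1 else - c j) *\<^sub>R m j)"
        using b by simp
      moreover have "(\<Sum>j\<in>J. (if j = b then 1 else - c j) *\<^sub>R m j) = (\<Sum>j\<in>J. (- c j) *\<^sub>R m j)"
        using b by (intro sum.cong) auto
      ultimately have "(\<Sum>j\<in>UNIV. (if j = b then 1 else if j \<in> J then - c j else 0) *\<^sub>R m j) = 0"
        by (simp add: sum_negf)
      from indep[OF this] show False by (metis zero_neq_one)
    qed
    define e where "e = u /\<^sub>R norm u"
    have ee: "e \<bullet> e = 1"
      using \<open>u \<noteq> 0\<close> by (simp add: e_def power2_norm_eq_inner[symmetric] power2_eq_square field_simps)
    have qu: "q i \<bullet> u = 0" if "i \<in> J" for i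
    proof -
      have "(\<Sum>k\<in>J. (q k \<bullet> m b) * (q i \<bullet> q k)) = (\<Sum>k\<in>J. if k = i then q k \<bullet> m b else 0)"
        using that orth by (intro sum.cong) auto
      also have "\<dots> = q i \<bullet> m b" using that by simp
      finally show ?thesis by (simp add: u_def inner_diff_right inner_sum_right)
    qed
    then have qe: "q i \<bullet> e = 0" "e \<bullet> q i = 0" if "i \<in> J" for i
      using that by (auto simp: e_def inner_commute)
    define q' where "q' = q(b := e)"
    \<comment> \<open>Column \<open>b\<close> holds the projections onto the earlier
      \<open>q i\<close> and, on the diagonal, the length of the residual; row \<open>b\<close> is
      zero in the earlier columns.\<close>
    define r' where "r' i j = (if j = b then if i = b then norm u else q i \<bullet> m b
       else if i = b then 0 else r i j)" for i j
    have "m j = (\<Sum>i\<in>insert b J. r' i j *\<^sub>R q' i)" if "j \<in> insert b J" for j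
    proof (cases "j = b")
      case True
      have "(\<Sum>i\<in>insert b J. r' i j *\<^sub>R q' i) = norm u *\<^sub>R e + (\<Sum>i\<in>J. r' i j *\<^sub>R q' i)"
        using b True by (simp add: r'_def q'_def)
      also have "(\<Sum>i\<in>J. r' i j *\<^sub>R q' i) = (\<Sum>i\<in>J. (q i \<bullet> m b) *\<^sub>R q i)"
        using b True by (intro sum.cong) (auto simp: r'_def q'_def)
      finally show ?thesis using True \<open>u \<noteq> 0\<close> by (simp add: e_def u_def)
    next
      case False
      have "(\<Sum>i\<in>insert b J. r' i j *\<^sub>R q' i) = (\<Sum>i\<in>J. r' i j *\<^sub>R q' i)"
        using b False by (simp add: r'_def)
      also have "\<dots> = (\<Sum>i\<in>J. r i j *\<^sub>R q i)"
        using b False by (intro sum.cong) (auto simp: r'_def q'_def)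
      finally show ?thesis using exp[of j] that False by simp
    qed
    moreover have "q' ` insert b J \<subseteq> span (m ` insert b J)"
    proof -
      have mono: "span (m ` J) \<subseteq> span (m ` insert b J)" by (intro span_mono) auto
      have "u \<in> span (m ` insert b J)"
        unfolding u_def using mono psp by (intro span_diff) (auto intro: span_base)
      then have "e \<in> span (m ` insert b J)" unfolding e_def by (rule span_scale)
      with mono sp b show ?thesis by (auto simp: q'_def)
    qed
    moreover have "\<forall>i\<in>insert b J. \<forall>j\<in>insert b J. q' i \<bullet> q' j = (if i = j then 1 else 0)"
      using b orth qe ee by (auto simp: q'_def)
    moreover have "\<forall>j\<in>insert b J. 0 < r' j j"
      using pos b \<open>u \<noteq> 0\<close> by (auto simp: r'_def)
    moreover have "\<forall>i\<in>insert b J. \<forall>j\<in>insert b J. j < i \<longrightarrow> r' i j = 0"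
      using tri insert.hyps(2) by (auto simp: r'_def dest: less_asym)
    ultimately show ?case
      by (intro exI[of _ q'] exI[of _ r'] conjI ballI) blast+
  qed
  then show ?thesis by blast
qed

lemma exists_QR:
  fixes M :: "('n::{finite,linorder}) sqmat"
  assumes "invertible M"
  shows "\<exists>Q R. is_QR M Q R"
proof -
  have mult: "M *v x = (\<Sum>j\<in>UNIV. (x $ j) *\<^sub>R column j M)" for x
    by (simp add: matrix_mult_sum scalar_mult_eq_scaleR)
  have "\<forall>j. c j = 0" if "(\<Sum>j\<in>UNIV. c j *\<^sub>R column j M) = 0" for c
  proof -
    have "M *v (\<chi> j. c j) = 0" using that by (simp add: mult)
    with assms show ?thesis by (auto simp: invertible_iff_kernel vec_eq_iff)
  qed
  from gram_schmidt[of "\<lambda>j. column j M" UNIV, OF this] obtain q and r where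
    orth: "\<forall>i\<in>UNIV. \<forall>j\<in>UNIV. q i \<bullet> q j = (if i = j then 1 else 0)"
    and R: "\<forall>j\<in>UNIV. column j M = (\<Sum>i\<in>UNIV. r i j *\<^sub>R q i) \<and> 0 < r j j \<and>
      (\<forall>i\<in>UNIV. j < i \<longrightarrow> r i j = (0::real))"
    by blast
  have exp: "column j M = (\<Sum>i\<in>UNIV. r i j *\<^sub>R q i)" and pos: "0 < r j j" for j
    using R by blast+
  have tri: "r i j = 0" if "j < i" for i j
    using R that by blast
  define Q :: "'n sqmat" where "Q = (\<chi> a b. q b $ a)"
  define R :: "'n sqmat" where "R = (\<chi> i j. r i j)"
  have "M $ a $ j = (Q ** R) $ a $ j" for a j
    using arg_cong[OF exp[of j], of "\<lambda>x. x $ a"]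
    by (simp add: column_def Q_def R_def matrix_matrix_mult_def mult.commute)
  then have "M = Q ** R" by (simp add: vec_eq_iff)
  moreover have "transpose Q ** Q = mat 1"
    using orth by (auto simp: vec_eq_iff Q_def matrix_matrix_mult_def transpose_def mat_def inner_vec_def)
  then have "orthogonal_matrix Q" by (simp add: orthogonal_matrix)
  ultimately have "is_QR M Q R" using pos tri by (simp add: is_QR_def R_def)
  then show ?thesis by blast
qed

lemma is_QR_qr: "invertible M \<Longrightarrow> is_QR M (fst (qr M)) (snd (qr M))"
  using exists_QR[of M] someI_ex[of "\<lambda>(Q, R). is_QR M Q R"] by (auto simp: qr_def case_prod_unfold)

section \<open>Diagonal entries of R, norms and determinants\<close>

lemma norm_orthogonal_matrix_mult:
  fixes Q :: "('n::finite) sqmat"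
  assumes "orthogonal_matrix Q"
  shows "norm (Q *v x) = norm x"
  using assms orthogonal_transformation_matrix[of "(*v) Q"]
  by (simp add: orthogonal_transformation)

text \<open>With \<open>x\<close> equal to 1 at \<open>i\<close> and 0 beyond, triangularity leaves
  only the diagonal term in component \<open>i\<close> of \<open>R *v x\<close>; orthogonality of
  \<open>Q\<close> identifies the norms of \<open>R *v x\<close> and \<open>M *v x\<close>.\<close>

lemma upper_triangular_diag_le:
  fixes M :: "('n::{finite,linorder}) sqmat"
  assumes QR: "M = Q ** R" "orthogonal_matrix Q" and tri: "\<And>i j. j < i \<Longrightarrow> R $ i $ j = 0"
    and x: "\<And>j. i < j \<Longrightarrow> x $ j = 0" "x $ i = 1"
  shows "R $ i $ i \<le> norm (M *v x)"
proof -
  have "(R *v x) $ i = (\<Sum>j\<in>UNIV. if j = i then R $ i $ i else 0)"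
    unfolding matrix_vector_mult_def vec_lambda_beta
    by (intro sum.cong) (use tri x in \<open>auto simp: not_less_iff_gr_or_eq elim!: linorder_neqE\<close>)
  then have "R $ i $ i \<le> \<bar>(R *v x) $ i\<bar>" by simp
  also have "\<dots> \<le> norm (R *v x)" by (rule component_le_norm_cart)
  also have "\<dots> = norm (M *v x)"
    using norm_orthogonal_matrix_mult[OF QR(2), of "R *v x"] QR(1) by (simp add: matrix_vector_mul_assoc)
  finally show ?thesis .
qed

lemma abs_det_orthogonal_mult:
  fixes Q R :: "('n::finite) sqmat"
  assumes "orthogonal_matrix Q"
  shows "\<bar>det (Q ** R)\<bar> = \<bar>det R\<bar>"
  using det_orthogonal_matrix[OF assms] by (auto simp: det_mul abs_mult)

text \<open>In the QR-decomposition each diagonal entry of \<open>R\<close> is at most the norm of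
  the image of a unit coordinate vector, hence at most \<open>b\<close>; their product is the
  absolute determinant.\<close>

lemma abs_det_le_power:
  fixes M :: "('n::{finite,linorder}) sqmat"
  assumes le: "\<And>x. norm (M *v x) \<le> b * norm x"
  shows "\<bar>det M\<bar> \<le> b ^ CARD('n)"
proof (cases "invertible M")
  case True
  then obtain Q R where QR: "M = Q ** R" "orthogonal_matrix Q"
    and tri: "\<And>i j. j < i \<Longrightarrow> R $ i $ j = 0" and pos: "\<And>i. 0 < R $ i $ i"
    using exists_QR by (force simp: is_QR_def)
  have "R $ i $ i \<le> b" for i
  proof -
    have "R $ i $ i \<le> norm (M *v axis i 1)"
      by (rule upper_triangular_diag_le[OF QR tri]) (auto simp: axis_def)
    also have "\<dots> \<le> b" using le[of "axis i 1"] by simp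
    finally show ?thesis .
  qed
  then have "(\<Prod>i\<in>UNIV. R $ i $ i) \<le> (\<Prod>i\<in>(UNIV :: 'n set). b)"
    using pos by (intro prod_mono) (auto intro: less_imp_le)
  moreover have "\<bar>det M\<bar> = (\<Prod>i\<in>UNIV. R $ i $ i)"
    using QR pos by (simp add: abs_det_orthogonal_mult det_upper_triangular[OF tri] abs_prod)
      (metis abs_of_pos)
  ultimately show ?thesis by simp
next
  case False
  have "0 \<le> b" using order_trans[OF norm_ge_zero le[of "axis undefined 1"]] by simp
  with False show ?thesis by (simp add: invertible_det_nz)
qed

text \<open>The relative bound makes \<open>S ** matrix_inv T\<close> stretch by at most
  \<open>b\<close>, and the determinant is multiplicative.\<close>

lemma abs_det_mono_power:
  fixes S T :: "('n::{finite,linorder}) sqmat"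
  assumes le: "\<And>x. norm (S *v x) \<le> b * norm (T *v x)" and T: "invertible T"
  shows "\<bar>det S\<bar> \<le> b ^ CARD('n) * \<bar>det T\<bar>"
proof -
  note inv = matrix_inv_mult[OF T]
  have "norm ((S ** matrix_inv T) *v x) \<le> b * norm x" for x
    using le[of "matrix_inv T *v x"] inv(1) by (simp add: matrix_vector_mul_assoc)
  then have "\<bar>det (S ** matrix_inv T)\<bar> \<le> b ^ CARD('n)" by (rule abs_det_le_power)
  then have "\<bar>det (S ** matrix_inv T)\<bar> * \<bar>det T\<bar> \<le> b ^ CARD('n) * \<bar>det T\<bar>"
    by (rule mult_right_mono) simp
  then have "\<bar>det ((S ** matrix_inv T) ** T)\<bar> \<le> b ^ CARD('n) * \<bar>det T\<bar>"
    by (simp add: det_mul abs_mult)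
  then show ?thesis using inv(2) by (simp add: matrix_mul_assoc[symmetric])
qed

section \<open>Perturbed linear systems\<close>

lemma DERIV_max_0_power:
  assumes "2 \<le> n"
  shows "((\<lambda>x::real. max 0 x ^ n) has_real_derivative real n * max 0 x ^ (n - 1)) (at x)"
proof -
  consider "0 < x" | "x < 0" | "x = 0" by linarith
  then show ?thesis
  proof cases
    case 1
    have "((\<lambda>x. x ^ n) has_real_derivative real n * x ^ (n - 1)) (at x)"
      by (auto intro!: derivative_eq_intros)
    then have "((\<lambda>x. max 0 x ^ n) has_real_derivative real n * x ^ (n - 1)) (at x)"
      by (rule has_field_derivative_transform_within_open[of _ _ _ "{0<..}"]) (use 1 in auto)
    with 1 show ?thesis by simp
  next
    case 2
    have "((\<lambda>x. 0) has_real_derivative 0) (at x)" by simp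
    then have "((\<lambda>x. max 0 x ^ n) has_real_derivative 0) (at x)"
      by (rule has_field_derivative_transform_within_open[of _ _ _ "{..<0}"])
        (use 2 assms in \<open>auto simp: power_0_left\<close>)
    with 2 assms show ?thesis by (simp add: power_0_left)
  next
    case 3
    \<comment> \<open>At 0 the difference quotient is dominated by
      \<open>\<bar>h\<bar> ^ (n - 1)\<close>; an exponent \<open>n\<close> of at least 2 makes this
      power positive.\<close>
    have "((\<lambda>h::real. max 0 h ^ n / h) \<longlongrightarrow> 0) (at 0)"
    proof (rule Lim_null_comparison)
      show "((\<lambda>h::real. \<bar>h\<bar> ^ (n - 1)) \<longlongrightarrow> 0) (at 0)"
        using assms by (auto intro!: tendsto_eq_intros)
      have "norm (max 0 h ^ n / h) \<le> \<bar>h\<bar> ^ (n - 1)" if "h \<noteq> 0" for h :: real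
        using that assms by (cases n) (auto simp: max_def power_0_left)
      then show "\<forall>\<^sub>F h in at 0. norm (max 0 h ^ n / h) \<le> \<bar>h::real\<bar> ^ (n - 1)"
        by (auto simp: eventually_at_filter)
    qed
    then show ?thesis using 3 assms by (simp add: DERIV_def power_0_left)
  qed
qed

lemma smooth_step:
  obtains \<psi> \<psi>' :: "real \<Rightarrow> real" where
    "\<And>x. (\<psi> has_real_derivative \<psi>' x) (at x)" "continuous_on UNIV \<psi>'"
    "\<And>x. x \<le> 0 \<Longrightarrow> \<psi> x = 0 \<and> \<psi>' x = 0" "\<And>x. 1 \<le> x \<Longrightarrow> \<psi> x = 1 \<and> \<psi>' x = 0"
    "\<And>x. 0 \<le> \<psi> x \<and> \<psi> x \<le> 1" "\<And>x. 0 \<le> \<psi>' x \<and> \<psi>' x \<le> 2"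
proof
  let ?p = "\<lambda>n x. max 0 x ^ n :: real"
  \<comment> \<open>\<open>3x\<^sup>2 - 2x\<^sup>3\<close> on \<open>[0, 1]\<close>, extended by constants.\<close>
  define \<psi> where "\<psi> x = 3 * ?p 2 x - 2 * ?p 3 x + 3 * ?p 2 (x - 1) + 2 * ?p 3 (x - 1)" for x
  define \<psi>' where "\<psi>' x = 6 * ?p 1 x - 6 * ?p 2 x + 6 * ?p 1 (x - 1) + 6 * ?p 2 (x - 1)" for x
  show "(\<psi> has_real_derivative \<psi>' x) (at x)" for x
    unfolding \<psi>_def \<psi>'_def
    by (rule derivative_eq_intros DERIV_max_0_power[THEN DERIV_chain2] DERIV_max_0_power refl | simp)+
  show "continuous_on UNIV \<psi>'"
    unfolding \<psi>'_def by (intro continuous_intros)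
  show low: "\<psi> x = 0 \<and> \<psi>' x = 0" if "x \<le> 0" for x
    using that by (auto simp: \<psi>_def \<psi>'_def max_def)
  show high: "\<psi> x = 1 \<and> \<psi>' x = 0" if "1 \<le> x" for x
    using that by (auto simp: \<psi>_def \<psi>'_def max_def power2_eq_square power3_eq_cube algebra_simps)
  \<comment> \<open>The right-hand sides exhibit the signs needed below: products of nonnegative
    factors, and a square completed at \<open>x = 1 / 2\<close>, where \<open>\<psi>'\<close> has
    its maximum 3/2.\<close>
  have mid: "\<psi> x = x * x * (3 - 2 * x)" "1 - \<psi> x = (1 - x) * (1 - x) * (1 + 2 * x)"
    "\<psi>' x = 6 * x * (1 - x)" "2 - \<psi>' x = 1 / 2 + 6 * ((x - 1 / 2) * (x - 1 / 2))"
    if "0 \<le> x" "x \<le> 1" for x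
    using that by (auto simp: \<psi>_def \<psi>'_def max_def power2_eq_square power3_eq_cube field_simps)
  show "0 \<le> \<psi> x \<and> \<psi> x \<le> 1" for x
  proof (cases "0 \<le> x \<and> x \<le> 1")
    case True
    then have "0 \<le> \<psi> x" "0 \<le> 1 - \<psi> x" using mid[of x] by (auto intro!: mult_nonneg_nonneg)
    then show ?thesis by simp
  next
    case False
    then show ?thesis using low[of x] high[of x] by auto
  qed
  show "0 \<le> \<psi>' x \<and> \<psi>' x \<le> 2" for x
  proof (cases "0 \<le> x \<and> x \<le> 1")
    case True
    then have "0 \<le> \<psi>' x" using mid[of x] by (auto intro!: mult_nonneg_nonneg)
    moreover have "0 \<le> 2 - \<psi>' x" using mid(4)[of x] True by simp
    ultimately show ?thesis by simp
  next
    case False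
    then show ?thesis using low[of x] high[of x] by auto
  qed
qed

text \<open>One smooth step per interval is summed. Each step is flat at both ends of its interval,
  so the pieces join with a continuous derivative; \<open>a\<close> and \<open>b\<close> are the
  values of the step and of its derivative, in the time variable rescaled to the unit
  interval.\<close>

lemma C1_interpolation:
  fixes M :: "nat \<Rightarrow> 'a::real_normed_vector" and t :: "nat \<Rightarrow> real"
  assumes t: "strict_mono t" "filterlim t at_top sequentially"
  obtains F F' where
    "\<And>s. (F has_vector_derivative F' s) (at s)" "continuous_on UNIV F'"
    "\<And>n. F (t n) = M n"
    "\<And>n s. t n \<le> s \<Longrightarrow> s \<le> t (Suc n) \<Longrightarrow> \<exists>a b. 0 \<le> a \<and> a \<le> 1 \<and> 0 \<le> b \<and> b \<le> 2 \<and>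
       F s = M n + a *\<^sub>R (M (Suc n) - M n) \<and>
       F' s = (b / (t (Suc n) - t n)) *\<^sub>R (M (Suc n) - M n)"
proof -
  obtain \<psi> and \<psi>' :: "real \<Rightarrow> real" where
    \<psi>: "\<And>x. (\<psi> has_real_derivative \<psi>' x) (at x)" "continuous_on UNIV \<psi>'"
    and lo: "\<And>x. x \<le> 0 \<Longrightarrow> \<psi> x = 0 \<and> \<psi>' x = 0" and hi: "\<And>x. 1 \<le> x \<Longrightarrow> \<psi> x = 1 \<and> \<psi>' x = 0"
    and bd: "\<And>x. 0 \<le> \<psi> x \<and> \<psi> x \<le> 1" "\<And>x. 0 \<le> \<psi>' x \<and> \<psi>' x \<le> 2"
    using smooth_step by blast
  define h where "h k = t (Suc k) - t k" for k
  have h: "0 < h k" for k using t(1) by (simp add: h_def strict_mono_def)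
  have tm: "t m \<le> t n" if "m \<le> n" for m n
    using t(1) that by (simp add: strict_mono_less_eq)
  define S where "S n s = M 0 + (\<Sum>k<n. \<psi> ((s - t k) / h k) *\<^sub>R (M (Suc k) - M k))" for n s
  define S' where "S' n s = (\<Sum>k<n. (\<psi>' ((s - t k) / h k) / h k) *\<^sub>R (M (Suc k) - M k))" for n s
  have tele: "M 0 + (\<Sum>k<n. M (Suc k) - M k) = M n" for n
    by (simp add: sum_lessThan_telescope)
  \<comment> \<open>Terms with index at least \<open>m\<close> have not started at a time
    \<open>s \<le> t m\<close>, so the partial sums stabilize.\<close>
  have Seq: "S n s = S m s \<and> S' n s = S' m s" if "m \<le> n" "s \<le> t m" for m n s
  proof -
    have "(s - t k) / h k \<le> 0" if "m \<le> k" for k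
      using that \<open>s \<le> t m\<close> tm[of m k] h[of k] by (auto simp: divide_le_0_iff)
    then have "\<psi> ((s - t k) / h k) = 0" "\<psi>' ((s - t k) / h k) = 0" if "m \<le> k" for k
      using lo that by blast+
    then show ?thesis
      using \<open>m \<le> n\<close> unfolding S_def S'_def
      by (intro conjI arg_cong[where f = "(+) (M 0)"] sum.mono_neutral_right) auto
  qed
  have ex: "\<exists>n. s < t n" for s
    using t(2) by (auto simp: filterlim_at_top_dense eventually_sequentially)
  \<comment> \<open>With \<open>s\<close> strictly before \<open>t (N s)\<close>, a single partial
    sum represents \<open>F\<close> on a neighbourhood of \<open>s\<close>.\<close>
  define N where "N s = (LEAST n. s < t n)" for s
  have N: "s < t (N s)" for s unfolding N_def using ex by (rule LeastI_ex)
  define F where "F s = S (N s) s" for s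
  define F' where "F' s = S' (N s) s" for s
  have F: "F s = S n s \<and> F' s = S' n s" if "s \<le> t n" for s n
    using Seq[of n "N s" s] Seq[of "N s" n s] that N[of s]
    by (cases "n \<le> N s") (auto simp: F_def F'_def)
  have Sd: "(S n has_vector_derivative S' n s) (at s)" for n s
  proof -
    have "((\<lambda>s. \<psi> ((s - t k) / h k)) has_real_derivative \<psi>' ((s - t k) / h k) / h k) (at s)" for k
    proof -
      have "((\<lambda>s. (s - t k) / h k) has_real_derivative 1 / h k) (at s)"
        using h[of k] by (auto intro!: derivative_eq_intros)
      from DERIV_chain2[OF \<psi>(1) this] show ?thesis by simp
    qed
    note * = has_vector_derivative_scaleR[OF this has_vector_derivative_const, simplified]
    show ?thesis unfolding S_def S'_def
      by (rule derivative_eq_intros * refl | simp)+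
  qed
  show thesis
  proof (rule that)
    show "(F has_vector_derivative F' s) (at s)" for s
    proof (rule has_vector_derivative_transform_within_open)
      show "(S (N s) has_vector_derivative F' s) (at s)" using Sd by (simp add: F'_def)
      show "open {..<t (N s)}" by simp
      show "s \<in> {..<t (N s)}" using N by simp
      show "S (N s) r = F r" if "r \<in> {..<t (N s)}" for r using F[of r "N s"] that by simp
    qed
    have S'c: "continuous_on UNIV (S' n)" for n
      unfolding S'_def
      by (intro continuous_intros continuous_on_compose2[OF \<psi>(2)]) (use h less_imp_neq in fastforce)+
    have "isCont F' s" for s
    proof -
      have "isCont (S' (N s)) s" using S'c by (simp add: continuous_on_eq_continuous_at)
      moreover have "\<forall>\<^sub>F r in nhds s. F' r = S' (N s) r"
        using F N by (intro eventually_mono[OF eventually_nhds_in_open[of "{..<t (N s)}"]]) auto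
      ultimately show ?thesis by (subst isCont_cong)
    qed
    then show "continuous_on UNIV F'" by (simp add: continuous_on_eq_continuous_at)
    \<comment> \<open>Steps from earlier intervals are already complete at \<open>t n\<close>, and
      their increments telescope to \<open>M n\<close>.\<close>
    have grid: "1 \<le> (t n - t k) / h k" if "k < n" for k n
      using tm[of "Suc k" n] that h[of k] by (simp add: h_def)
    show "F (t n) = M n" for n
      using F[of "t n" n] hi grid tele by (simp add: S_def)
    show "\<exists>a b. 0 \<le> a \<and> a \<le> 1 \<and> 0 \<le> b \<and> b \<le> 2 \<and>
       F s = M n + a *\<^sub>R (M (Suc n) - M n) \<and>
       F' s = (b / (t (Suc n) - t n)) *\<^sub>R (M (Suc n) - M n)" if s: "t n \<le> s" "s \<le> t (Suc n)" for n s
    proof -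
      have "1 \<le> (s - t k) / h k" if "k < n" for k
      proof -
        have "1 \<le> (t n - t k) / h k" using grid that by simp
        also have "\<dots> \<le> (s - t k) / h k" using s h[of k] by (intro divide_right_mono) auto
        finally show ?thesis .
      qed
      then have "F s = M n + \<psi> ((s - t n) / h n) *\<^sub>R (M (Suc n) - M n)"
        "F' s = (\<psi>' ((s - t n) / h n) / h n) *\<^sub>R (M (Suc n) - M n)"
        using F[OF s(2)] hi by (simp_all add: S_def S'_def tele add.assoc[symmetric])
      then show ?thesis using bd unfolding h_def by blast
    qed
  qed
qed

section \<open>Growth of solutions and continuity of the inverse matrix\<close>

lemma bounded_linear_matrix_vector_left: "bounded_linear (\<lambda>M :: ('n::finite) sqmat. M *v c)"
  by (intro linear_conv_bounded_linear[THEN iffD1] linearI)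
    (simp_all add: matrix_vector_mult_add_rdistrib scaleR_matrix_vector_assoc)

lemma bounded_bilinear_matrix_mult: "bounded_bilinear ((**) :: ('n::finite) sqmat \<Rightarrow> _)"
  unfolding bilinear_conv_bounded_bilinear[symmetric] bilinear_def
  by (auto intro!: linearI simp: vec_eq_iff matrix_matrix_mult_def
      sum_distrib_left algebra_simps sum.distrib)

lemma fundamental_matrix_column:
  assumes "fundamental_matrix A X" "0 \<le> t"
  shows "((\<lambda>t. X t *v c) has_vector_derivative A t *v (X t *v c)) (at t within {0..})"
  using bounded_linear.has_vector_derivative[OF bounded_linear_matrix_vector_left, of X "A t ** X t"] assms
  by (auto simp: fundamental_matrix_def matrix_vector_mul_assoc)

text \<open>A Gronwall argument in both directions: the squared norm weighted by
  \<open>exp (-2 * K * r)\<close> decreases and weighted by \<open>exp (2 * K * r)\<close>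
  increases. The backward bound later compares the fundamental matrix at two times within one
  step.\<close>

lemma solution_growth:
  fixes x :: "real \<Rightarrow> real^'n::finite"
  assumes x: "\<And>t. 0 \<le> t \<Longrightarrow> (x has_vector_derivative A t *v x t) (at t within {0..})"
    and K: "\<And>t. 0 \<le> t \<Longrightarrow> opnorm (A t) \<le> K" and st: "0 \<le> s" "s \<le> t"
  shows "norm (x t) \<le> exp (K * (t - s)) * norm (x s)" "norm (x s) \<le> exp (K * (t - s)) * norm (x t)"
proof -
  have cont: "continuous_on {s..t} x"
    using continuous_on_vector_derivative[of "{0..}" x "\<lambda>t. A t *v x t"] x st
    by (auto intro: continuous_on_subset)
  have deriv: "((\<lambda>r. exp (c * r) * (x r \<bullet> x r)) has_real_derivative
      exp (c * r) * (c * (x r \<bullet> x r) + 2 * ((A r *v x r) \<bullet> x r))) (at r)"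
    if r: "s < r" for c r
  proof -
    have "r \<in> interior {0..}" using r st by (simp add: interior_real_atLeast)
    then have xr: "(x has_vector_derivative A r *v x r) (at r)"
      using x[of r] r st at_within_interior[of r "{0..}"] by simp
    have "((\<lambda>r. x r \<bullet> x r) has_vector_derivative x r \<bullet> (A r *v x r) + (A r *v x r) \<bullet> x r) (at r)"
      by (rule bounded_bilinear.has_vector_derivative[OF bounded_bilinear_inner xr xr])
    then have "((\<lambda>r. x r \<bullet> x r) has_real_derivative 2 * ((A r *v x r) \<bullet> x r)) (at r)"
      by (simp add: has_real_derivative_iff_has_vector_derivative inner_commute)
    then show ?thesis
      by - (rule derivative_eq_intros refl | assumption | simp add: algebra_simps)+
  qed
  have bd: "\<bar>(A r *v x r) \<bullet> x r\<bar> \<le> K * (x r \<bullet> x r)" if "0 \<le> r" for r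
  proof -
    have "\<bar>(A r *v x r) \<bullet> x r\<bar> \<le> norm (A r *v x r) * norm (x r)" by (rule Cauchy_Schwarz_ineq2)
    also have "\<dots> \<le> (K * norm (x r)) * norm (x r)"
      by (intro mult_right_mono order_trans[OF norm_le_opnorm] K that) auto
    finally show ?thesis by (simp add: dot_square_norm power2_eq_square)
  qed
  have contg: "continuous_on {s..t} (\<lambda>r. exp (c * r) * (x r \<bullet> x r))" for c :: real
    using cont by (intro continuous_intros)
  have e1: "exp (2 * K * r) * (exp (-2 * K * r) * z) = z" "exp (-2 * K * r) * (exp (2 * K * r) * z) = z" for r z :: real
    by (simp_all add: mult.assoc[symmetric] mult_exp_exp)
  have "2 * K * t + -2 * K * s = 2 * (K * (t - s))" by (simp add: algebra_simps)
  then have e2: "exp (2 * K * t) * (exp (-2 * K * s) * z) = exp (2 * (K * (t - s))) * z"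
    "exp (-2 * K * s) * (exp (2 * K * t) * z) = exp (2 * (K * (t - s))) * z" for z
    unfolding mult.assoc[symmetric] mult_exp_exp by (simp_all add: add.commute)
  have sq: "norm a \<le> exp e * norm b" if "a \<bullet> a \<le> exp (2 * e) * (b \<bullet> b)" for a b :: "real^'n" and e
  proof (rule power2_le_imp_le)
    have "exp (2 * e) = (exp e)\<^sup>2" by (metis exp_double)
    with that show "(norm a)\<^sup>2 \<le> (exp e * norm b)\<^sup>2" by (simp add: power_mult_distrib dot_square_norm)
  qed simp
  have "exp (-2 * K * t) * (x t \<bullet> x t) \<le> exp (-2 * K * s) * (x s \<bullet> x s)"
  proof (rule DERIV_nonpos_imp_decreasing_open[OF st(2) _ contg])
    fix r assume "s < r" "r < t"
    then show "\<exists>y. ((\<lambda>r. exp (-2 * K * r) * (x r \<bullet> x r)) has_real_derivative y) (at r) \<and> y \<le> 0"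
      using bd[of r] st by (intro exI[of _ "exp (-2 * K * r) * (-2 * K * (x r \<bullet> x r) + 2 * ((A r *v x r) \<bullet> x r))"]
          conjI deriv) (auto simp: mult_le_0_iff)
  qed
  then have "exp (2 * K * t) * (exp (-2 * K * t) * (x t \<bullet> x t)) \<le> exp (2 * K * t) * (exp (-2 * K * s) * (x s \<bullet> x s))"
    by (rule mult_left_mono) simp
  then show "norm (x t) \<le> exp (K * (t - s)) * norm (x s)"
    unfolding e1 e2 by (rule sq)
  have "exp (2 * K * s) * (x s \<bullet> x s) \<le> exp (2 * K * t) * (x t \<bullet> x t)"
  proof (rule DERIV_nonneg_imp_increasing_open[OF st(2) _ contg])
    fix r assume "s < r" "r < t"
    then show "\<exists>y. ((\<lambda>r. exp (2 * K * r) * (x r \<bullet> x r)) has_real_derivative y) (at r) \<and> 0 \<le> y"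
      using bd[of r] st by (intro exI[of _ "exp (2 * K * r) * (2 * K * (x r \<bullet> x r) + 2 * ((A r *v x r) \<bullet> x r))"]
          conjI deriv) (auto simp: zero_le_mult_iff)
  qed
  then have "exp (-2 * K * s) * (exp (2 * K * s) * (x s \<bullet> x s)) \<le> exp (-2 * K * s) * (exp (2 * K * t) * (x t \<bullet> x t))"
    by (rule mult_left_mono) simp
  then show "norm (x s) \<le> exp (K * (t - s)) * norm (x t)"
    unfolding e1 e2 by (rule sq)
qed

text \<open>The entries are quotients of polynomials in the entries of \<open>M\<close>, the form
  from which continuity of the inverse is read off.\<close>

lemma matrix_inv_cramer:
  fixes M :: "('n::finite) sqmat"
  assumes "invertible M"
  shows "matrix_inv M = (\<chi> k l. det (\<chi> i j. if j = k then axis l 1 $ i else M $ i $ j) / det M)"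
proof -
  have "M *v (matrix_inv M *v axis l 1) = axis l 1" for l
    using matrix_inv_mult(1)[OF assms] by (simp add: matrix_vector_mul_assoc)
  moreover have "det M \<noteq> 0" using assms by (simp add: invertible_det_nz)
  ultimately have "matrix_inv M *v axis l 1 = (\<chi> k. det (\<chi> i j. if j = k then axis l 1 $ i else M $ i $ j) / det M)" for l
    using cramer[of M "matrix_inv M *v axis l 1" "axis l 1"] by simp
  then have "column l (matrix_inv M) = (\<chi> k. det (\<chi> i j. if j = k then axis l 1 $ i else M $ i $ j) / det M)" for l
    by (simp add: matrix_vector_mult_basis)
  then show ?thesis by (simp add: column_def vec_eq_iff)
qed

lemma continuous_on_matrix_inv:
  fixes Z :: "real \<Rightarrow> ('n::finite) sqmat"
  assumes "continuous_on S Z" "\<And>t. t \<in> S \<Longrightarrow> invertible (Z t)"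
  shows "continuous_on S (\<lambda>t. matrix_inv (Z t))"
proof -
  have det: "continuous_on S (\<lambda>t. det (W t))"
    if "\<And>i j. continuous_on S (\<lambda>t. W t $ i $ j)" for W :: "real \<Rightarrow> 'n sqmat"
    unfolding det_def using that by (intro continuous_on_sum continuous_on_mult continuous_on_prod continuous_on_const)
  have comp: "continuous_on S (\<lambda>t. Z t $ i $ j)" for i j
    using assms(1) by (intro continuous_intros)
  have "continuous_on S (\<lambda>t. (\<chi> k l. det (\<chi> i j. if j = k then axis l 1 $ i else Z t $ i $ j) / det (Z t)))"
  proof (intro continuous_on_vec_lambda continuous_on_divide det ballI)
    show "continuous_on S (\<lambda>t. (\<chi> i j. if j = k then axis l 1 $ i else Z t $ i $ j) $ i $ j)" for k l i j
      using comp by (cases "j = k") auto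
  qed (use comp assms(2) in \<open>auto simp: invertible_det_nz[symmetric]\<close>)
  then show ?thesis
    by (rule continuous_on_cong[THEN iffD1, rotated 2]) (auto simp: matrix_inv_cramer assms(2))
qed

text \<open>The sequence \<open>M\<close> is interpolated and multiplied by \<open>X\<close>.
  Hypothesis \<open>incr\<close> measures an increment of \<open>M\<close> as seen through
  \<open>X s\<close>, relative to \<open>X s *v (M n *v y)\<close>. The bound 1/2 keeps the
  interpolated matrix invertible. The constant 4 is the slope bound 2 of the step times the factor 2
  lost in comparing \<open>X s *v (M n *v y)\<close> with \<open>Z s *v y\<close>.\<close>

lemma perturbed_fundamental_matrix:
  fixes A X :: "real \<Rightarrow> ('n::finite) sqmat" and M :: "nat \<Rightarrow> 'n sqmat"
  assumes X: "fundamental_matrix A X"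
    and t: "strict_mono t" "t 0 = 0" "filterlim t at_top sequentially"
    and M: "\<And>n. invertible (M n)"
    and incr: "\<And>n s y. t n \<le> s \<Longrightarrow> s \<le> t (Suc n) \<Longrightarrow>
      norm (X s *v ((M (Suc n) - M n) *v y)) \<le> \<eta> * (t (Suc n) - t n) * norm (X s *v (M n *v y))"
    and \<eta>: "0 \<le> \<eta>" "\<And>n. \<eta> * (t (Suc n) - t n) \<le> 1 / 2"
  obtains Q Z where "continuous_on {0..} Q" "\<And>s. 0 \<le> s \<Longrightarrow> opnorm (Q s) \<le> 4 * \<eta>"
    "fundamental_matrix (\<lambda>s. A s + Q s) Z" "\<And>n. Z (t n) = X (t n) ** M n"
proof -
  obtain F F' where F: "\<And>s. (F has_vector_derivative F' s) (at s)" "continuous_on UNIV F'"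
    "\<And>n. F (t n) = M n"
    and piece: "\<And>n s. t n \<le> s \<Longrightarrow> s \<le> t (Suc n) \<Longrightarrow> \<exists>a b. 0 \<le> a \<and> a \<le> 1 \<and> 0 \<le> b \<and> b \<le> 2 \<and>
       F s = M n + a *\<^sub>R (M (Suc n) - M n) \<and>
       F' s = (b / (t (Suc n) - t n)) *\<^sub>R (M (Suc n) - M n)"
    by (rule C1_interpolation[OF t(1,3), of M]) blast
  define Z where "Z s = X s ** F s" for s
  define Q where "Q s = X s ** F' s ** matrix_inv (Z s)" for s
  have Xinv: "invertible (X s)" if "0 \<le> s" for s
    using X that by (auto simp: fundamental_matrix_def)
  have key: "norm ((X s ** F' s) *v y) \<le> 4 * \<eta> * norm (Z s *v y) \<and> (Z s *v y = 0 \<longrightarrow> y = 0)"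
    if s: "0 \<le> s" for s y
  proof -
    \<comment> \<open>The first grid time after \<open>s\<close> cannot have index 0, since
      \<open>t 0 = 0 \<le> s\<close>; its predecessor begins the interval containing
      \<open>s\<close>.\<close>
    define m where "m = (LEAST n. s < t n)"
    have ex: "\<exists>n. s < t n"
      using t(3) by (auto simp: filterlim_at_top_dense eventually_sequentially)
    have m: "s < t m" unfolding m_def using ex by (rule LeastI_ex)
    with s t(2) obtain n where n: "m = Suc n" by (cases m) auto
    have "t n \<le> s" using not_less_Least[of n "\<lambda>n. s < t n"] n by (auto simp: m_def)
    then have ns: "t n \<le> s" "s \<le> t (Suc n)" using m n by auto
    obtain a b where ab: "0 \<le> a" "a \<le> 1" "0 \<le> b" "b \<le> 2"
      and Fs: "F s = M n + a *\<^sub>R (M (Suc n) - M n)"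
      and F's: "F' s = (b / (t (Suc n) - t n)) *\<^sub>R (M (Suc n) - M n)"
      using piece[OF ns] by blast
    define h where "h = t (Suc n) - t n"
    have h: "0 < h" using t(1) by (simp add: h_def strict_mono_def)
    define u where "u = X s *v (M n *v y)"
    define d where "d = X s *v ((M (Suc n) - M n) *v y)"
    have d: "norm d \<le> \<eta> * h * norm u" using incr[OF ns] by (simp add: d_def u_def h_def)
    have d2: "norm d \<le> 1 / 2 * norm u"
      using d \<eta>(2)[of n] by (smt (verit) h_def mult_right_mono norm_ge_zero)
    have Zy: "Z s *v y = u + a *\<^sub>R d"
      by (simp add: Z_def Fs u_def d_def matrix_vector_mul_assoc[symmetric]
          matrix_vector_mult_add_rdistrib matrix_vector_right_distrib
          scaleR_matrix_vector_assoc[symmetric] matrix_vector_mult_scaleR)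
    have Fy: "(X s ** F' s) *v y = (b / h) *\<^sub>R d"
      by (simp add: F's d_def h_def matrix_vector_mul_assoc[symmetric]
          scaleR_matrix_vector_assoc[symmetric] matrix_vector_mult_scaleR)
    have "norm (a *\<^sub>R d) \<le> 1 * norm d" using mult_right_mono[of a 1 "norm d"] ab by simp
    then have "norm u \<le> norm (Z s *v y) + 1 / 2 * norm u"
      using norm_triangle_ineq4[of "Z s *v y" "a *\<^sub>R d"] d2 Zy by simp
    then have u: "norm u \<le> 2 * norm (Z s *v y)" by simp
    have "norm ((X s ** F' s) *v y) = b / h * norm d" using ab h by (simp add: Fy)
    also have "\<dots> \<le> 2 / h * (\<eta> * h * norm u)"
      using ab h d by (intro mult_mono divide_right_mono) auto
    also have "\<dots> = 2 * \<eta> * norm u" using h by simp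
    also have "\<dots> \<le> 2 * \<eta> * (2 * norm (Z s *v y))" using u \<eta> by (intro mult_left_mono) auto
    finally have "norm ((X s ** F' s) *v y) \<le> 4 * \<eta> * norm (Z s *v y)" by simp
    moreover have "y = 0" if "Z s *v y = 0"
    proof -
      have "X s *v (M n *v y) = 0" using u that by (simp add: u_def)
      then show ?thesis using Xinv[OF s] M[of n] unfolding invertible_iff_kernel by blast
    qed
    ultimately show ?thesis by blast
  qed
  then have Zinv: "invertible (Z s)" if "0 \<le> s" for s
    using that by (auto simp: invertible_iff_kernel)
  have Xd: "(X has_vector_derivative A s ** X s) (at s within {0..})" if "0 \<le> s" for s
    using X that by (auto simp: fundamental_matrix_def)
  have Zd: "(Z has_vector_derivative X s ** F' s + (A s ** X s) ** F s) (at s within {0..})" if "0 \<le> s" for s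
    unfolding Z_def
    by (rule bounded_bilinear.has_vector_derivative[OF bounded_bilinear_matrix_mult Xd[OF that]
        has_vector_derivative_at_within[OF F(1)]])
  show thesis
  proof (rule that)
    have "continuous_on {0..} X" "continuous_on {0..} Z"
      using Xd Zd by (auto intro!: continuous_on_vector_derivative)
    then show "continuous_on {0..} Q" unfolding Q_def
      using F(2) Zinv
      by (intro bounded_bilinear.continuous_on[OF bounded_bilinear_matrix_mult] continuous_on_matrix_inv)
        (auto intro: continuous_on_subset)
    show "opnorm (Q s) \<le> 4 * \<eta>" if "0 \<le> s" for s
    proof (rule opnorm_le)
      fix x
      have "norm ((X s ** F' s) *v (matrix_inv (Z s) *v x)) \<le> 4 * \<eta> * norm (Z s *v (matrix_inv (Z s) *v x))"
        using key[OF that] by blast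
      then show "norm (Q s *v x) \<le> 4 * \<eta> * norm x"
        using matrix_inv_mult(1)[OF Zinv[OF that]] by (simp add: Q_def matrix_vector_mul_assoc)
    qed
    \<comment> \<open>\<open>Q\<close> was defined so that \<open>Q s ** Z s\<close> is the term of
      the product rule in which \<open>F\<close> is differentiated.\<close>
    have "X s ** F' s + (A s ** X s) ** F s = (A s + Q s) ** Z s" if "0 \<le> s" for s
    proof -
      have "Q s ** Z s = X s ** F' s ** (matrix_inv (Z s) ** Z s)"
        by (simp only: Q_def matrix_mul_assoc)
      then have "Q s ** Z s = X s ** F' s" using matrix_inv_mult(2)[OF Zinv[OF that]] by simp
      then show ?thesis by (simp add: Z_def bounded_bilinear.add_left[OF bounded_bilinear_matrix_mult] matrix_mul_assoc add.commute)
    qed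
    then show "fundamental_matrix (\<lambda>s. A s + Q s) Z"
      using Zd Zinv by (auto simp: fundamental_matrix_def)
    show "Z (t n) = X (t n) ** M n" for n by (simp add: Z_def F(3))
  qed
qed

section \<open>Lyapunov exponents\<close>

lemma scaled_elog_le_iff:
  assumes "0 < t"
  shows "ereal (1 / t) * elog r \<le> ereal b \<longleftrightarrow> r \<le> exp (b * t)"
proof (cases "r \<le> 0")
  case True
  then show ?thesis using assms by (simp add: elog_def order_trans[OF True])
next
  case False
  then have "r \<le> exp (b * t) \<longleftrightarrow> ln r \<le> b * t" by (metis exp_le_cancel_iff exp_ln not_le)
  with False assms show ?thesis by (simp add: elog_def field_simps)
qed

lemma less_scaled_elog_iff:
  assumes "0 < t"
  shows "ereal b < ereal (1 / t) * elog r \<longleftrightarrow> exp (b * t) < r"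
  using scaled_elog_le_iff[OF assms, of r b] by (meson not_le)

text \<open>The upper limit is replaced by eventual bounds with real rates strictly above
  \<open>a\<close>, a form that stays meaningful when \<open>a\<close> is infinite or
  \<open>x t\<close> is zero.\<close>

lemma lyap_exp_le_iff:
  "lyap_exp x \<le> a \<longleftrightarrow> (\<forall>b::real. a < ereal b \<longrightarrow> (\<forall>\<^sub>F t in at_top. norm (x t) \<le> exp (b * t)))"
proof (intro iffI allI impI)
  fix b :: real assume "lyap_exp x \<le> a" "a < ereal b"
  then have "\<forall>\<^sub>F t in at_top. ereal (1 / t) * elog (norm (x t)) < ereal b"
    unfolding lyap_exp_def by (intro Limsup_lessD) simp
  then show "\<forall>\<^sub>F t in at_top. norm (x t) \<le> exp (b * t)"
    using eventually_gt_at_top[of 0]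
    by eventually_elim (metis scaled_elog_le_iff less_imp_le)
next
  assume *: "\<forall>b::real. a < ereal b \<longrightarrow> (\<forall>\<^sub>F t in at_top. norm (x t) \<le> exp (b * t))"
  show "lyap_exp x \<le> a"
  proof (rule ccontr)
    assume "\<not> ?thesis"
    then obtain b where b: "a < ereal b" "ereal b < lyap_exp x" using ereal_dense2 by (meson not_le)
    from * b have "\<forall>\<^sub>F t in at_top. norm (x t) \<le> exp (b * t)" by blast
    then have "\<forall>\<^sub>F t in at_top. ereal (1 / t) * elog (norm (x t)) \<le> ereal b"
      using eventually_gt_at_top[of 0] by eventually_elim (simp add: scaled_elog_le_iff)
    then have "lyap_exp x \<le> ereal b" unfolding lyap_exp_def by (rule Limsup_bounded)
    with b show False by simp
  qed
qed

text \<open>The branch for negative times follows the convention of \<open>solution\<close>, so that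
  coefficients \<open>c\<close> correspond to solutions as functions on the whole line.\<close>

definition sol_of :: "(real \<Rightarrow> ('n::finite) sqmat) \<Rightarrow> real^'n \<Rightarrow> real \<Rightarrow> real^'n" where
  "sol_of Z c = (\<lambda>t. if t < 0 then 0 else Z t *v c)"

lemma lyap_exp_sol_le_iff:
  "lyap_exp (sol_of Z c) \<le> a \<longleftrightarrow>
    (\<forall>b::real. a < ereal b \<longrightarrow> (\<forall>\<^sub>F t in at_top. norm (Z t *v c) \<le> exp (b * t)))"
proof -
  have "(\<forall>\<^sub>F t in at_top. norm (sol_of Z c t) \<le> exp (b * t)) \<longleftrightarrow>
    (\<forall>\<^sub>F t in at_top. norm (Z t *v c) \<le> exp (b * t))" for b
    by (rule eventually_cong[OF eventually_ge_at_top[of 0]]) (simp add: sol_of_def)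
  then show ?thesis by (simp add: lyap_exp_le_iff)
qed

text \<open>Between \<open>a\<close> and \<open>b\<close> lies a rate \<open>b'\<close>; the gap
  \<open>b - b'\<close> gives an exponential factor that absorbs the constant
  \<open>\<bar>k\<bar> + 1\<close> of a linear combination.\<close>

lemma subspace_lyap_le: "subspace {c. lyap_exp (sol_of Z c) \<le> a}"
proof -
  have comb: "lyap_exp (sol_of Z (k *\<^sub>R x + y)) \<le> a"
    if "lyap_exp (sol_of Z x) \<le> a" "lyap_exp (sol_of Z y) \<le> a" for k x y
    unfolding lyap_exp_sol_le_iff
  proof (intro allI impI)
    fix b :: real assume "a < ereal b"
    then obtain b' where b': "a < ereal b'" "b' < b" using ereal_dense2[of a "ereal b"] by auto
    have "filterlim (\<lambda>t. exp ((b - b') * t)) at_top at_top"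
      by (rule filterlim_compose[OF exp_at_top])
        (rule filterlim_tendsto_pos_mult_at_top[OF tendsto_const _ filterlim_ident], use b' in simp)
    then have "\<forall>\<^sub>F t in at_top. \<bar>k\<bar> + 1 \<le> exp ((b - b') * t)"
      by (simp add: filterlim_at_top)
    moreover have "\<forall>\<^sub>F t in at_top. norm (Z t *v x) \<le> exp (b' * t)"
      "\<forall>\<^sub>F t in at_top. norm (Z t *v y) \<le> exp (b' * t)"
      using that b' by (auto simp: lyap_exp_sol_le_iff)
    ultimately show "\<forall>\<^sub>F t in at_top. norm (Z t *v (k *\<^sub>R x + y)) \<le> exp (b * t)"
    proof eventually_elim
      case (elim t)
      have "norm (Z t *v (k *\<^sub>R x + y)) \<le> \<bar>k\<bar> * norm (Z t *v x) + norm (Z t *v y)"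
        by (metis matrix_vector_mult_scaleR matrix_vector_right_distrib norm_scaleR norm_triangle_ineq)
      also have "\<dots> \<le> \<bar>k\<bar> * exp (b' * t) + exp (b' * t)"
        using elim by (intro add_mono mult_left_mono) auto
      also have "\<dots> = (\<bar>k\<bar> + 1) * exp (b' * t)" by (simp add: algebra_simps)
      also have "\<dots> \<le> exp ((b - b') * t) * exp (b' * t)" using elim by (intro mult_right_mono) auto
      also have "\<dots> = exp (b * t)" by (simp add: mult_exp_exp algebra_simps)
      finally show ?case .
    qed
  qed
  have zero: "lyap_exp (sol_of Z 0) \<le> a" by (simp add: lyap_exp_sol_le_iff)
  show ?thesis
  proof (rule subspaceI)
    show "x + y \<in> {c. lyap_exp (sol_of Z c) \<le> a}"
      if "x \<in> {c. lyap_exp (sol_of Z c) \<le> a}" "y \<in> {c. lyap_exp (sol_of Z c) \<le> a}" for x y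
      using comb[of x y 1] that by simp
    show "k *\<^sub>R x \<in> {c. lyap_exp (sol_of Z c) \<le> a}" if "x \<in> {c. lyap_exp (sol_of Z c) \<le> a}" for k x
      using comb[of x 0 k] that zero by simp
  qed (use zero in simp)
qed

text \<open>This locates a position of the spectrum in its block; the inequality says that the
  earlier blocks end at or before position \<open>k\<close>.\<close>

lemma nth_concat_replicate:
  assumes "k < (\<Sum>l<q. m l)"
  shows "\<exists>i<q. concat (map (\<lambda>i. replicate (m i) (f i)) [0..<q]) ! k = f i \<and> (\<Sum>l<i. m l) \<le> k"
  using assms
proof (induction q)
  case (Suc q)
  have len: "length (concat (map (\<lambda>i. replicate (m i) (f i)) [0..<q])) = (\<Sum>l<q. m l)"
    by (simp add: length_concat comp_def interv_sum_list_conv_sum_set_nat atLeast0LessThan)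
  show ?case
  proof (cases "k < (\<Sum>l<q. m l)")
    case True
    with Suc.IH len show ?thesis by (auto simp: nth_append less_Suc_eq)
  next
    case False
    with Suc.prems len show ?thesis by (intro exI[of _ q]) (auto simp: nth_append)
  qed
qed simp

section \<open>Solution spaces and the spectrum of one system\<close>

context
  fixes B Z :: "real \<Rightarrow> ('n::{finite,linorder}) sqmat" and K :: real
  assumes Z: "fundamental_matrix B Z" and K: "\<And>t. 0 \<le> t \<Longrightarrow> opnorm (B t) \<le> K"
begin

lemma inj_sol_of: "inj (sol_of Z)"
proof (rule injI)
  fix c d assume "sol_of Z c = sol_of Z d"
  then have "Z 0 *v (c - d) = 0"
    by (auto simp: sol_of_def fun_eq_iff matrix_vector_mult_diff_distrib dest: spec[of _ 0])
  moreover have "invertible (Z 0)" using Z by (auto simp: fundamental_matrix_def)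
  ultimately have "c - d = 0" unfolding invertible_iff_kernel by blast
  then show "c = d" by simp
qed

lemma solution_iff: "solution B x \<longleftrightarrow> x \<in> range (sol_of Z)"
proof
  assume x: "solution B x"
  define c where "c = matrix_inv (Z 0) *v x 0"
  have Z0: "invertible (Z 0)" using Z by (auto simp: fundamental_matrix_def)
  \<comment> \<open>The difference from the candidate solution is a solution that starts at 0, and
    the growth bound keeps it 0.\<close>
  have "((\<lambda>t. x t - Z t *v c) has_vector_derivative B t *v (x t - Z t *v c)) (at t within {0..})"
    if "0 \<le> t" for t
    unfolding matrix_vector_mult_diff_distrib
    by (intro has_vector_derivative_diff fundamental_matrix_column[OF Z that])
      (use x that in \<open>simp add: solution_def\<close>)
  from solution_growth(1)[OF this K, of 0] have "norm (x t - Z t *v c) \<le> exp (K * t) * norm (x 0 - Z 0 *v c)"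
    if "0 \<le> t" for t using that by simp
  moreover have "Z 0 *v c = x 0"
    using matrix_inv_mult(1)[OF Z0] by (simp add: c_def matrix_vector_mul_assoc)
  ultimately have "x t = Z t *v c" if "0 \<le> t" for t using that by fastforce
  then have "x = sol_of Z c" using x by (auto simp: sol_of_def fun_eq_iff solution_def)
  then show "x \<in> range (sol_of Z)" by simp
next
  assume "x \<in> range (sol_of Z)"
  then obtain c where c: "x = sol_of Z c" by blast
  have "(sol_of Z c has_vector_derivative B t *v (Z t *v c)) (at t within {0..})" if "0 \<le> t" for t
    by (rule has_vector_derivative_transform[OF _ _ fundamental_matrix_column[OF Z that]])
      (use that in \<open>auto simp: sol_of_def\<close>)
  then show "solution B x" by (auto simp: solution_def c sol_of_def)
qed

lemma sol_of_eq_0_iff: "sol_of Z c = (\<lambda>_. 0) \<longleftrightarrow> c = 0"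
proof -
  have "sol_of Z 0 = (\<lambda>_. 0)" by (auto simp: sol_of_def)
  then show ?thesis using inj_sol_of by (metis injD)
qed

lemma lyap_values_eq: "lyap_values B = (\<lambda>c. lyap_exp (sol_of Z c)) ` (- {0})"
  unfolding lyap_values_def solution_iff using sol_of_eq_0_iff by blast

text \<open>Distinct values belong to strictly nested subspaces of coefficients, whose dimensions
  lie between 0 and \<open>CARD('n)\<close>.\<close>

lemma finite_lyap_values: "finite (lyap_values B)"
proof -
  let ?U = "\<lambda>a. {c. lyap_exp (sol_of Z c) \<le> a}"
  have "dim (?U a) < dim (?U b)" if "a < b" "b \<in> lyap_values B" for a b
  proof (rule dim_psubset)
    from that obtain c where "lyap_exp (sol_of Z c) = b" by (auto simp: lyap_values_eq)
    with that have "?U a \<subseteq> ?U b" "c \<in> ?U b" "c \<notin> ?U a" by auto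
    then have "?U a \<subset> ?U b" by blast
    then show "span (?U a) \<subset> span (?U b)"
      by (simp add: span_eq_iff[THEN iffD2, OF subspace_lyap_le])
  qed
  then have "inj_on (\<lambda>a. dim (?U a)) (lyap_values B)"
    by (intro linorder_inj_onI') (metis less_irrefl)
  moreover have "(\<lambda>a. dim (?U a)) ` lyap_values B \<subseteq> {..CARD('n)}"
    using dim_subset_UNIV_cart by auto
  ultimately show ?thesis by (meson finite_atMost inj_on_finite)
qed

text \<open>The multiplicities are dimensions in a function space; linearity and injectivity move
  them to \<open>real^'n\<close>.\<close>

lemma dim_sol_of_image: "vector_space.dim fun_scale (sol_of Z ` S) = dim S"
proof -
  interpret vs: finite_dimensional_vector_space_pair_1 "scaleR :: real \<Rightarrow> (real, 'n) vec \<Rightarrow> _" Basis fun_scale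
    by (intro finite_dimensional_vector_space_pair_1.intro vector_space_fun_scale
        eucl.finite_dimensional_vector_space_axioms)
  have "Vector_Spaces.linear scaleR fun_scale (sol_of Z)"
    by unfold_locales (auto simp: sol_of_def fun_eq_iff matrix_vector_right_distrib matrix_vector_mult_scaleR)
  from vs.dim_image_eq[OF this, of S] show ?thesis
    using inj_on_subset[OF inj_sol_of] by (simp add: dim_raw_def)
qed

text \<open>Multiplicities telescope, so the blocks before block \<open>l\<close> contain as many
  positions as the codimension of the space of block \<open>l\<close>. If \<open>i\<close> lies in
  that block, at most \<open>card {j. j < i}\<close> positions precede it.\<close>

theorem dim_lyap_le_Lyap:
  "CARD('n) \<le> dim {c. lyap_exp (sol_of Z c) \<le> Lyap B i} + card {j. j < i}"
proof -
  define vs where "vs = lyap_distinct B"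
  define q where "q = length vs"
  define U where "U i = (if i < q then {c. lyap_exp (sol_of Z c) \<le> vs ! i} else {0})" for i
  have set: "set vs = lyap_values B"
    using finite_lyap_values by (simp add: vs_def lyap_distinct_def)
  have desc: "vs ! j \<le> vs ! i" if "i \<le> j" "j < q" for i j
    using that unfolding q_def vs_def lyap_distinct_def
    by (intro sorted_rev_nth_mono) auto
  have space: "lyap_space B i = sol_of Z ` U i" for i
  proof -
    have "sol_of Z ` {0} = {\<lambda>_. 0}" using sol_of_eq_0_iff by auto
    then show ?thesis
      unfolding lyap_space_def U_def vs_def[symmetric] q_def[symmetric] solution_iff by auto
  qed
  define D where "D i = dim (U i)" for i
  have mult: "lyap_mult B i = D i - D (Suc i)" for i
    by (simp add: lyap_mult_def space dim_sol_of_image D_def)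
  have "(axis undefined 1 :: (real, 'n) vec) \<noteq> 0" by (simp add: axis_eq_0_iff)
  then have "lyap_values B \<noteq> {}" unfolding lyap_values_eq by blast
  then have q: "0 < q" using set by (auto simp: q_def)
  have zero: "lyap_exp (sol_of Z 0) \<le> a" for a by (simp add: lyap_exp_sol_le_iff)
  \<comment> \<open>The first space is everything: exponents of nonzero coefficients occur in the
    list, whose head is the largest.\<close>
  have "lyap_exp (sol_of Z c) \<le> vs ! 0" for c
  proof (cases "c = 0")
    case False
    then have "lyap_exp (sol_of Z c) \<in> set vs" by (auto simp: set lyap_values_eq)
    then show ?thesis using desc[of 0] by (metis in_set_conv_nth q_def zero_le)
  qed (use zero in simp)
  then have D0: "D 0 = CARD('n)" using q by (simp add: D_def U_def dim_UNIV)
  have Dq: "D q = 0" by (simp add: D_def U_def)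
  \<comment> \<open>\<open>lyap_mult\<close> subtracts natural numbers, so the telescoping sum needs
    \<open>D\<close> to be nonincreasing.\<close>
  have "U (Suc i) \<subseteq> U i" if "i < q" for i
    using that desc[of i "Suc i"] zero by (auto simp: U_def intro: order_trans)
  then have mono: "D (Suc i) \<le> D i" if "i < q" for i
    unfolding D_def using that by (intro dim_subset)
  have tele: "(\<Sum>l<i. lyap_mult B l) + D i = CARD('n)" if "i \<le> q" for i
    using that
  proof (induction i)
    case (Suc i)
    then show ?case using mono[of i] by (simp add: mult)
  qed (simp add: D0)
  have "card {j. j < i} < CARD('n)"
    by (intro psubset_card_mono) auto
  then obtain l where l: "l < q" "Lyap B i = vs ! l" "(\<Sum>k<l. lyap_mult B k) \<le> card {j. j < i}"
    using nth_concat_replicate[of "card {j. j < i}" "lyap_mult B" q "(!) vs"] tele[of q] Dq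
    by (auto simp: Lyap_def lyap_spectrum_def vs_def q_def)
  have "{c. lyap_exp (sol_of Z c) \<le> Lyap B i} = U l" using l by (simp add: U_def)
  then show ?thesis using tele[of l] l by (simp add: D_def)
qed

end

section \<open>Generic tuples of vectors\<close>

text \<open>The set is contained in the image of a hyperplane, a null set, under a differentiable
  map. Row \<open>j\<close> of the preimage stores the coefficients \<open>c\<close>, and
  \<open>c j = 0\<close> says that its diagonal entry vanishes; the other rows are those of
  \<open>v\<close>.\<close>

lemma negligible_rows_dependent:
  fixes w :: "'n::finite \<Rightarrow> real^'n" and K :: "'n set"
  assumes "j \<in> K"
  shows "negligible {v :: 'n sqmat. \<exists>c. c j = 0 \<and>
    v $ j = (\<Sum>l\<in>UNIV. c l *\<^sub>R (if l \<in> K then v $ l else w l))}" (is "negligible ?N")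
proof -
  define J where "J x = (\<chi> i. if i = j then x else 0)" for x :: "real^'n"
  define P where "P u = (\<chi> i. if i = j then 0 else u $ i)" for u :: "'n sqmat"
  \<comment> \<open>\<open>g\<close> reads the coefficients from row \<open>j\<close> and replaces
    that row by the combination they encode. Coefficient \<open>j\<close> multiplies row
    \<open>j\<close> or \<open>w j\<close>, but it is 0 on the hyperplane.\<close>
  define g where "g u = P u + J (\<Sum>l\<in>UNIV. (u $ j $ l) *\<^sub>R (if l \<in> K then u $ l else w l))"
    for u :: "'n sqmat"
  have J: "linear J" and P: "linear P"
    by (auto intro!: linearI simp: J_def P_def vec_eq_iff)
  have "(\<lambda>u :: 'n sqmat. u $ j $ l) differentiable (at u)" "(\<lambda>u :: 'n sqmat. u $ l) differentiable (at u)" for l u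
    by (auto intro!: linear_imp_differentiable linearI)
  then have "(\<lambda>u :: 'n sqmat. (u $ j $ l) *\<^sub>R (if l \<in> K then u $ l else w l)) differentiable (at u)" for l u
    by (cases "l \<in> K") auto
  then have "(\<lambda>u. J (\<Sum>l\<in>UNIV. (u $ j $ l) *\<^sub>R (if l \<in> K then u $ l else w l))) differentiable (at u)" for u
    by (intro differentiable_compose[of J, OF linear_imp_differentiable[OF J]] differentiable_sum) auto
  then have "g differentiable (at u)" for u
    unfolding g_def by (intro differentiable_add linear_imp_differentiable[OF P])
  then have diff: "g differentiable_on S" for S
    by (simp add: differentiable_at_imp_differentiable_on)
  have "(\<lambda>u :: 'n sqmat. u $ j $ j) = (\<lambda>u. axis j (axis j 1) \<bullet> u)"
    by (simp add: fun_eq_iff inner_axis' )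
  then have "{u :: 'n sqmat. u $ j $ j = 0} = {u. axis j (axis j 1) \<bullet> u = 0}"
    by (metis (no_types))
  then have "negligible {u :: 'n sqmat. u $ j $ j = 0}"
    by (simp add: negligible_hyperplane axis_eq_0_iff)
  then have "negligible (g ` {u. u $ j $ j = 0})"
    by (rule negligible_differentiable_image_negligible[OF order_refl _ diff])
  moreover have "?N \<subseteq> g ` {u. u $ j $ j = 0}"
  proof safe
    fix v :: "'n sqmat" and c
    assume c: "c j = 0" "v $ j = (\<Sum>l\<in>UNIV. c l *\<^sub>R (if l \<in> K then v $ l else w l))"
    define u :: "'n sqmat" where "u = (\<chi> i. if i = j then (\<chi> l. c l) else v $ i)"
    have "(\<Sum>l\<in>UNIV. (u $ j $ l) *\<^sub>R (if l \<in> K then u $ l else w l)) = v $ j"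
      unfolding c(2) by (intro sum.cong) (auto simp: u_def c(1))
    then have "g u = P u + J (v $ j)" by (simp only: g_def)
    also have "\<dots> = v" by (simp add: J_def P_def u_def vec_eq_iff)
    finally have "g u = v" .
    moreover have "u $ j $ j = 0" by (simp add: u_def c)
    ultimately show "v \<in> g ` {u. u $ j $ j = 0}" by blast
  qed
  ultimately show ?thesis by (rule negligible_subset)
qed

text \<open>A dependency among the rows either involves a row in \<open>K\<close>, which is then a
  combination of the others and puts \<open>v\<close> in a null set, or involves only the fixed rows
  \<open>w\<close>, which are independent.\<close>

lemma AE_rows_invertible:
  fixes w :: "'n::finite \<Rightarrow> real^'n" and K :: "'n set"
  assumes indep: "\<And>c. (\<Sum>j\<in>-K. c j *\<^sub>R w j) = 0 \<Longrightarrow> \<forall>j\<in>-K. c j = 0"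
  shows "AE v in lebesgue. invertible ((\<chi> i. if i \<in> K then v $ i else w i) :: 'n sqmat)"
proof -
  let ?N = "\<lambda>j. {v :: 'n sqmat. \<exists>c. c j = 0 \<and>
    v $ j = (\<Sum>l\<in>UNIV. c l *\<^sub>R (if l \<in> K then v $ l else w l))}"
  have "negligible (\<Union>j\<in>K. ?N j)"
    using negligible_rows_dependent by (intro negligible_Union) auto
  then have "AE v in lebesgue. v \<notin> (\<Union>j\<in>K. ?N j)"
    by (intro AE_not_in) (simp add: negligible_iff_null_sets)
  then show ?thesis
  proof (rule AE_mp[OF _ AE_I2], intro impI)
    fix v :: "'n sqmat"
    assume v: "v \<notin> (\<Union>j\<in>K. ?N j)"
    define m where "m l = (if l \<in> K then v $ l else w l)" for l
    have "\<forall>i. c i = 0" if c: "(\<Sum>i\<in>UNIV. c i *\<^sub>R m i) = 0" for c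
    proof (rule ccontr)
      assume ne: "\<not> ?thesis"
      show False
      proof (cases "\<exists>j\<in>K. c j \<noteq> 0")
        case True
        then obtain j where j: "j \<in> K" "c j \<noteq> 0" by blast
        define a where "a l = (if l = j then 0 else - c l / c j)" for l
        have "(\<Sum>i\<in>UNIV - {j}. c i *\<^sub>R m i) = - (c j *\<^sub>R m j)"
          using c by (simp add: sum.remove[of UNIV j] add_eq_0_iff)
        moreover have "(\<Sum>l\<in>UNIV. a l *\<^sub>R m l) = (\<Sum>l\<in>UNIV - {j}. (- 1 / c j) *\<^sub>R (c l *\<^sub>R m l))"
          by (intro sum.mono_neutral_cong_right) (auto simp: a_def)
        moreover have "\<dots> = (- 1 / c j) *\<^sub>R (\<Sum>l\<in>UNIV - {j}. c l *\<^sub>R m l)"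
          by (simp only: scaleR_sum_right)
        ultimately have "(\<Sum>l\<in>UNIV. a l *\<^sub>R m l) = (- 1 / c j) *\<^sub>R (- (c j *\<^sub>R m j))"
          by simp
        then have "v $ j = (\<Sum>l\<in>UNIV. a l *\<^sub>R m l)" using j by (simp add: m_def)
        then show False using v j by (auto simp: m_def a_def)
      next
        case False
        then have "(\<Sum>i\<in>UNIV. c i *\<^sub>R m i) = (\<Sum>i\<in>-K. c i *\<^sub>R w i)"
          by (intro sum.mono_neutral_cong_right) (auto simp: m_def)
        then show False using False ne indep[of c] c by auto
      qed
    qed
    then have "\<exists>B. (\<chi> i. m i) ** B = (mat 1 :: 'n sqmat)"
      unfolding matrix_right_invertible_independent_rows
      by (simp add: row_def scalar_mult_eq_scaleR)
    then show "invertible ((\<chi> i. if i \<in> K then v $ i else w i) :: 'n sqmat)"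
      unfolding m_def invertible_right_inverse by simp
  qed
qed

text \<open>The rows from \<open>i\<close> on are replaced by independent vectors of
  \<open>U\<close>; the dimension hypothesis provides enough of them. Together with the generic rows
  before \<open>i\<close> they form a basis, in which \<open>v $ i\<close> is expanded; subtracting
  the part along the rows before \<open>i\<close> leaves a vector of \<open>U\<close>.\<close>

lemma AE_reduce_into_subspace:
  fixes U :: "(real^'n::{finite,linorder}) set"
  assumes U: "subspace U" "CARD('n) \<le> dim U + card {j. j < i}"
  shows "AE v :: 'n sqmat in lebesgue. \<exists>x. x $ i = 1 \<and> (\<forall>j>i. x $ j = 0) \<and> transpose v *v x \<in> U"
proof -
  define K where "K = {j. j < i}"
  obtain B where B: "B \<subseteq> U" "independent B" "card B = dim U"
    by (rule basis_exists[of U])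
  have "card (- K) \<le> card B" using U(2) B(3) by (simp add: K_def Compl_eq_Diff_UNIV card_Diff_subset)
  then obtain g where g: "g ` (- K) \<subseteq> B" "inj_on g (- K)"
    using card_le_inj[of "- K" B] independent_imp_finite[OF B(2)] by auto
  have "\<forall>j\<in>-K. c j = 0" if c: "(\<Sum>j\<in>-K. c j *\<^sub>R g j) = 0" for c
  proof -
    let ?c = "\<lambda>b. c (the_inv_into (- K) g b)"
    have "(\<Sum>b\<in>g ` (- K). ?c b *\<^sub>R b) = 0"
      using c g(2) by (simp add: sum.reindex the_inv_into_f_f)
    then have "\<forall>b\<in>g ` (- K). ?c b = 0"
      using independent_mono[OF B(2) g(1)] by (auto simp: independent_explicit)
    then show ?thesis using g(2) by (auto simp: the_inv_into_f_f)
  qed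
  then have "AE v in lebesgue. invertible ((\<chi> i. if i \<in> K then v $ i else g i) :: 'n sqmat)"
    by (intro AE_rows_invertible)
  then show ?thesis
  proof (rule AE_mp[OF _ AE_I2], intro impI)
    fix v :: "'n sqmat"
    define m where "m l = (if l \<in> K then v $ l else g l)" for l
    assume "invertible ((\<chi> i. if i \<in> K then v $ i else g i) :: 'n sqmat)"
    then have "invertible (transpose (\<chi> i. m i))"
      by (simp add: m_def invertible_det_nz det_transpose)
    \<comment> \<open>Genericity is used only for the rows before \<open>i\<close>;
      \<open>v $ i\<close> itself is an arbitrary vector expanded in the basis.\<close>
    from matrix_inv_mult(1)[OF this] obtain a where "transpose (\<chi> i. m i) *v a = v $ i"
      by (metis matrix_vector_mul_assoc matrix_vector_mul_lid)
    then have a: "v $ i = (\<Sum>l\<in>UNIV. (a $ l) *\<^sub>R m l)"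
      by (simp add: matrix_mult_sum scalar_mult_eq_scaleR column_def transpose_def)
    have split: "(\<Sum>l\<in>UNIV. (a $ l) *\<^sub>R m l) = (\<Sum>l\<in>-K. (a $ l) *\<^sub>R g l) + (\<Sum>l\<in>K. (a $ l) *\<^sub>R v $ l)"
    proof -
      have "(\<Sum>l\<in>UNIV. (a $ l) *\<^sub>R m l) = (\<Sum>l\<in>-K. (a $ l) *\<^sub>R m l) + (\<Sum>l\<in>K. (a $ l) *\<^sub>R m l)"
        using sum.subset_diff[of K UNIV] by (simp add: Compl_eq_Diff_UNIV)
      then show ?thesis by (simp add: m_def)
    qed
    define x where "x = (\<chi> j. if j = i then 1 else if j \<in> K then - a $ j else 0)"
    have "transpose v *v x = (\<Sum>l\<in>UNIV. (x $ l) *\<^sub>R v $ l)"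
      by (simp add: matrix_mult_sum scalar_mult_eq_scaleR column_def transpose_def)
    also have "\<dots> = (\<Sum>l\<in>insert i K. (x $ l) *\<^sub>R v $ l)"
      by (intro sum.mono_neutral_right) (auto simp: x_def)
    also have "\<dots> = v $ i + (\<Sum>l\<in>K. (x $ l) *\<^sub>R v $ l)"
      by (simp add: K_def x_def)
    also have "(\<Sum>l\<in>K. (x $ l) *\<^sub>R v $ l) = (\<Sum>l\<in>K. - ((a $ l) *\<^sub>R v $ l))"
      by (intro sum.cong) (auto simp: x_def K_def)
    also have "v $ i + \<dots> = (\<Sum>l\<in>-K. (a $ l) *\<^sub>R g l)"
      unfolding a split by (simp add: sum_negf)
    also have "\<dots> \<in> U" using U(1) g(1) B(1) by (intro subspace_sum subspace_scale) auto
    finally have "transpose v *v x \<in> U" .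
    moreover have "x $ i = 1" "\<forall>j>i. x $ j = 0" by (auto simp: x_def K_def)
    ultimately show "\<exists>x. x $ i = 1 \<and> (\<forall>j>i. x $ j = 0) \<and> transpose v *v x \<in> U" by blast
  qed
qed

section \<open>Benettin's algorithm\<close>

primrec step_product :: "(real \<Rightarrow> real \<Rightarrow> 'n sqmat) \<Rightarrow> (nat \<Rightarrow> real) \<Rightarrow> nat \<Rightarrow> ('n::finite) sqmat" where
  "step_product \<Phi> h 0 = mat 1"
| "step_product \<Phi> h (Suc n) = step_matrix \<Phi> h (Suc n) ** step_product \<Phi> h n"

lemma upper_triangular_mult:
  fixes R S :: "('n::{finite,linorder}) sqmat"
  assumes R: "\<And>i j. j < i \<Longrightarrow> R $ i $ j = 0" and S: "\<And>i j. j < i \<Longrightarrow> S $ i $ j = 0"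
  shows "j < i \<Longrightarrow> (R ** S) $ i $ j = 0" "(R ** S) $ i $ i = R $ i $ i * S $ i $ i"
proof -
  have zero: "R $ i $ l * S $ l $ j = 0" if "l < i \<or> j < l" for i j l
    using R S that by auto
  show "(R ** S) $ i $ j = 0" if "j < i"
    unfolding matrix_matrix_mult_def vec_lambda_beta
    by (intro sum.neutral ballI zero) (use that in force)
  have "(\<Sum>l\<in>UNIV. R $ i $ l * S $ l $ i) = (\<Sum>l\<in>{i}. R $ i $ l * S $ l $ i)"
    by (intro sum.mono_neutral_right ballI zero) auto
  then show "(R ** S) $ i $ i = R $ i $ i * S $ i $ i" by (simp add: matrix_matrix_mult_def)
qed

context
  fixes \<Phi> :: "real \<Rightarrow> real \<Rightarrow> ('n::{finite,linorder}) sqmat" and h :: "nat \<Rightarrow> real"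
  assumes step: "\<And>n. invertible (step_matrix \<Phi> h (Suc n))"
begin

lemma invertible_step_product: "invertible (step_product \<Phi> h n)"
  by (induction n) (auto simp: step invertible_mult invertible_det_nz[of "mat 1"])

text \<open>The triangular factors multiply up, so the diagonal of \<open>S\<close> is the product
  of their diagonals. At \<open>n = 0\<close> the initial matrix is only invertible, which is why
  orthogonality is claimed from \<open>n = 1\<close> on.\<close>

lemma benettin_factorization:
  fixes v :: "'n sqmat"
  assumes v: "invertible v"
  obtains S where "step_product \<Phi> h n ** transpose v = benettin_V \<Phi> h v n ** S"
    "\<And>i j. j < i \<Longrightarrow> S $ i $ j = 0"
    "\<And>i. S $ i $ i = (\<Prod>k=1..n. benettin_R \<Phi> h v k $ i $ i)"
    "\<And>i k. 1 \<le> k \<Longrightarrow> k \<le> n \<Longrightarrow> 0 < benettin_R \<Phi> h v k $ i $ i"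
    "invertible (benettin_V \<Phi> h v n)" "1 \<le> n \<Longrightarrow> orthogonal_matrix (benettin_V \<Phi> h v n)"
proof -
  have "\<exists>S. step_product \<Phi> h n ** transpose v = benettin_V \<Phi> h v n ** S \<and>
    (\<forall>i j. j < i \<longrightarrow> S $ i $ j = 0) \<and>
    (\<forall>i. S $ i $ i = (\<Prod>k=1..n. benettin_R \<Phi> h v k $ i $ i)) \<and>
    (\<forall>i k. 1 \<le> k \<longrightarrow> k \<le> n \<longrightarrow> 0 < benettin_R \<Phi> h v k $ i $ i) \<and>
    invertible (benettin_V \<Phi> h v n) \<and> (1 \<le> n \<longrightarrow> orthogonal_matrix (benettin_V \<Phi> h v n))"
  proof (induction n)
    case 0
    have "invertible (transpose v)" using v by (simp add: invertible_det_nz det_transpose)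
    moreover have "(mat 1 :: 'n sqmat) $ i $ j = (if i = j then 1 else 0)" for i j
      by (simp add: mat_def)
    ultimately show ?case by (intro exI[of _ "mat 1"]) auto
  next
    case (Suc n)
    then obtain S where S: "step_product \<Phi> h n ** transpose v = benettin_V \<Phi> h v n ** S"
      and tri: "\<And>i j. j < i \<Longrightarrow> S $ i $ j = 0"
      and diag: "\<And>i. S $ i $ i = (\<Prod>k=1..n. benettin_R \<Phi> h v k $ i $ i)"
      and pos: "\<And>i k. 1 \<le> k \<Longrightarrow> k \<le> n \<Longrightarrow> 0 < benettin_R \<Phi> h v k $ i $ i"
      and inv: "invertible (benettin_V \<Phi> h v n)" by auto
    define R where "R = benettin_R \<Phi> h v (Suc n)"
    let ?M = "step_matrix \<Phi> h (Suc n) ** benettin_V \<Phi> h v n"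
    have "is_QR ?M (benettin_V \<Phi> h v (Suc n)) R"
      unfolding R_def benettin_R_def using is_QR_qr[OF invertible_mult[OF step inv]] by simp
    then have QR: "?M = benettin_V \<Phi> h v (Suc n) ** R" "orthogonal_matrix (benettin_V \<Phi> h v (Suc n))"
      and Rtri: "\<And>i j. j < i \<Longrightarrow> R $ i $ j = 0" and Rpos: "\<And>i. 0 < R $ i $ i"
      by (auto simp: is_QR_def)
    have "step_product \<Phi> h (Suc n) ** transpose v
        = step_matrix \<Phi> h (Suc n) ** (step_product \<Phi> h n ** transpose v)"
      by (simp add: matrix_mul_assoc)
    also have "\<dots> = ?M ** S" by (simp only: S matrix_mul_assoc)
    also have "\<dots> = benettin_V \<Phi> h v (Suc n) ** (R ** S)" by (simp only: QR matrix_mul_assoc)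
    finally have "step_product \<Phi> h (Suc n) ** transpose v = benettin_V \<Phi> h v (Suc n) ** (R ** S)" .
    moreover have "invertible (benettin_V \<Phi> h v (Suc n))"
      using QR(2) by (auto simp: invertible_def orthogonal_matrix_def)
    moreover have "(R ** S) $ i $ i = (\<Prod>k=1..Suc n. benettin_R \<Phi> h v k $ i $ i)" for i
      using upper_triangular_mult(2)[OF Rtri tri] diag by (simp add: R_def mult.commute)
    moreover have "0 < benettin_R \<Phi> h v k $ i $ i" if "1 \<le> k" "k \<le> Suc n" for i k
      using that pos[of k i] Rpos[of i] by (cases "k = Suc n") (auto simp: R_def)
    moreover have "(R ** S) $ i $ j = 0" if "j < i" for i j
      using upper_triangular_mult(1)[OF Rtri tri that] .
    ultimately show ?case using QR(2) by blast
  qed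
  then show thesis using that by blast
qed

text \<open>Exponentials undo the logarithms and turn outputs into diagonal entries of the
  accumulated factor; the triangular bound gives the first claim, the determinant the second. With
  \<open>grid h n \<noteq> 0\<close> the averaging factor cancels.\<close>

lemma benettin_output_bounds:
  fixes v :: "'n sqmat"
  assumes v: "invertible v" and n: "1 \<le> n" "grid h n \<noteq> 0"
  shows "x $ i = 1 \<Longrightarrow> \<forall>j>i. x $ j = 0 \<Longrightarrow>
      exp (grid h n * benettin_output \<Phi> h v i n) \<le> norm (step_product \<Phi> h n *v (transpose v *v x))"
    and "exp (grid h n * (\<Sum>i\<in>UNIV. benettin_output \<Phi> h v i n)) = \<bar>det (step_product \<Phi> h n)\<bar> * \<bar>det v\<bar>"
proof -
  obtain S where S: "step_product \<Phi> h n ** transpose v = benettin_V \<Phi> h v n ** S"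
    and tri: "\<And>i j. j < i \<Longrightarrow> S $ i $ j = 0"
    and diag: "\<And>i. S $ i $ i = (\<Prod>k=1..n. benettin_R \<Phi> h v k $ i $ i)"
    and pos: "\<And>i k. 1 \<le> k \<Longrightarrow> k \<le> n \<Longrightarrow> 0 < benettin_R \<Phi> h v k $ i $ i"
    and orth: "orthogonal_matrix (benettin_V \<Phi> h v n)"
    using benettin_factorization[OF v, of n] n(1) by metis
  have "exp (\<Sum>k=1..n. ln (benettin_R \<Phi> h v k $ i $ i)) = (\<Prod>k=1..n. benettin_R \<Phi> h v k $ i $ i)" for i
    unfolding exp_sum[OF finite_atLeastAtMost] using pos by (intro prod.cong) auto
  then have out: "exp (grid h n * benettin_output \<Phi> h v i n) = S $ i $ i" for i
    using n by (simp add: benettin_output_def diag)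
  show "exp (grid h n * benettin_output \<Phi> h v i n) \<le> norm (step_product \<Phi> h n *v (transpose v *v x))"
    if "x $ i = 1" "\<forall>j>i. x $ j = 0"
    unfolding out matrix_vector_mul_assoc by (rule upper_triangular_diag_le[OF S orth tri]) (use that in auto)
  have "exp (grid h n * (\<Sum>i\<in>UNIV. benettin_output \<Phi> h v i n)) = (\<Prod>i\<in>UNIV. S $ i $ i)"
    by (simp add: sum_distrib_left exp_sum out)
  also have "\<dots> = \<bar>\<Prod>i\<in>UNIV. S $ i $ i\<bar>"
    unfolding out[symmetric] by (simp add: abs_prod)
  also have "\<dots> = \<bar>det (step_product \<Phi> h n ** transpose v)\<bar>"
    unfolding S abs_det_orthogonal_mult[OF orth] by (simp add: det_upper_triangular[OF tri])
  finally show "exp (grid h n * (\<Sum>i\<in>UNIV. benettin_output \<Phi> h v i n)) = \<bar>det (step_product \<Phi> h n)\<bar> * \<bar>det v\<bar>"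
    by (simp add: det_mul abs_mult det_transpose)
qed

end

section \<open>Numerical steps compared with the exact flow\<close>

context
  fixes A X :: "real \<Rightarrow> ('n::{finite,linorder}) sqmat" and \<Phi> :: "real \<Rightarrow> real \<Rightarrow> 'n sqmat"
    and h e :: "nat \<Rightarrow> real" and K hmax :: real
  assumes X: "fundamental_matrix A X"
    and K: "\<And>t. 0 \<le> t \<Longrightarrow> opnorm (A t) \<le> K" "0 \<le> K"
    and step: "\<And>n. invertible (step_matrix \<Phi> h (Suc n))"
    and h: "\<And>n. 0 < h (Suc n)" "\<And>n. h (Suc n) \<le> hmax"
    and time: "filterlim (grid h) at_top sequentially"
    and e: "e \<longlonglongrightarrow> 0" "\<And>n. 0 \<le> e n"
    and err: "\<And>n y. norm (step_matrix \<Phi> h (Suc n) *v (X (grid h n) *v y) - X (grid h (Suc n)) *v y)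
        \<le> e n * h (Suc n) * norm (X (grid h n) *v y)"
begin

abbreviation (input) "Y \<equiv> step_product \<Phi> h"

lemma grid_simps: "grid h 0 = 0" "grid h (Suc n) = grid h n + h (Suc n)"
  by (simp_all add: grid_def)

lemma strict_mono_grid: "strict_mono (grid h)"
  by (rule strict_monoI_Suc) (simp add: grid_simps h)

lemma grid_nonneg: "0 \<le> grid h n"
  by (induction n) (auto simp: grid_simps intro: add_nonneg_nonneg less_imp_le[OF h(1)])

lemma X_invertible: "0 \<le> t \<Longrightarrow> invertible (X t)"
  using X by (auto simp: fundamental_matrix_def)

text \<open>A step is at most \<open>hmax\<close> long, so moving back inside it costs a factor that
  does not depend on \<open>n\<close>.\<close>

lemma X_growth:
  assumes "grid h n \<le> s" "s \<le> r" "r \<le> grid h (Suc n)"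
  shows "norm (X s *v c) \<le> exp (K * hmax) * norm (X r *v c)"
proof -
  have "norm (X s *v c) \<le> exp (K * (r - s)) * norm (X r *v c)"
    using assms grid_nonneg[of n]
    by (intro solution_growth(2)[of "\<lambda>t. X t *v c", OF fundamental_matrix_column[OF X] K(1)]) auto
  also have "\<dots> \<le> exp (K * hmax) * norm (X r *v c)"
    using assms h(2)[of n] K(2) by (intro mult_right_mono) (auto intro!: mult_left_mono simp: grid_simps)
  finally show ?thesis .
qed

text \<open>Per step the exact image is at most \<open>exp (2 * q)\<close> times the numerical one,
  with \<open>q\<close> proportional to \<open>e n * h (Suc n)\<close>. Taking determinants and
  multiplying over the steps, the loss is at most a constant times
  \<open>exp (\<eta> * grid h n)\<close>, because \<open>e n\<close> tends to 0.\<close>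

lemma det_lower_bound:
  assumes "0 < \<eta>"
  obtains C where "0 < C" "\<forall>\<^sub>F n in sequentially. \<bar>det (X (grid h n))\<bar> \<le> C * exp (\<eta> * grid h n) * \<bar>det (Y n)\<bar>"
proof -
  define E where "E = exp (K * hmax)"
  define d where "d = real CARD('n)"
  have d: "0 < d" by (simp add: d_def)
  have "(\<lambda>n. E * e n * hmax) \<longlonglongrightarrow> 0" "(\<lambda>n. 2 * E * e n * d) \<longlonglongrightarrow> 0"
    using e(1) by (auto intro!: tendsto_eq_intros)
  \<comment> \<open>The first bound will give \<open>q < 1 / 2\<close>; the second makes the
    determinant loss of a step at most \<open>exp (\<eta> * h (Suc n))\<close>.\<close>
  then have "\<forall>\<^sub>F n in sequentially. E * e n * hmax < 1 / 2 \<and> 2 * E * e n * d < \<eta>"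
    using assms by (intro eventually_conj order_tendstoD(2)) auto
  then obtain N where N: "\<And>n. N \<le> n \<Longrightarrow> E * e n * hmax < 1 / 2 \<and> 2 * E * e n * d < \<eta>"
    by (auto simp: eventually_sequentially)
  have stepdet: "\<bar>det (X (grid h (Suc n)))\<bar> * \<bar>det (Y n)\<bar>
      \<le> exp (\<eta> * h (Suc n)) * \<bar>det (X (grid h n))\<bar> * \<bar>det (Y (Suc n))\<bar>" if n: "N \<le> n" for n
  proof -
    define T where "T = step_matrix \<Phi> h (Suc n)"
    define q where "q = E * e n * h (Suc n)"
    have q0: "0 \<le> q" using e(2)[of n] h(1)[of n] by (simp add: q_def E_def)
    have "q \<le> E * e n * hmax" unfolding q_def using e(2)[of n] h(2)[of n] by (intro mult_left_mono) (auto simp: E_def)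
    then have q: "q < 1 / 2" using N[OF n] by simp
    have le: "norm (X (grid h (Suc n)) *v y) \<le> exp (2 * q) * norm ((T ** X (grid h n)) *v y)" for y
    proof -
      define s where "s = norm (X (grid h (Suc n)) *v y)"
      define r where "r = norm ((T ** X (grid h n)) *v y)"
      have "s \<le> r + e n * h (Suc n) * norm (X (grid h n) *v y)"
        using err[of n y] norm_triangle_sub[of "X (grid h (Suc n)) *v y" "(T ** X (grid h n)) *v y"]
        by (simp add: s_def r_def T_def matrix_vector_mul_assoc norm_minus_commute)
      also have "e n * h (Suc n) * norm (X (grid h n) *v y) \<le> e n * h (Suc n) * (E * s)"
        unfolding s_def E_def using e(2)[of n] h(1)[of n]
        by (intro mult_left_mono X_growth) (auto simp: grid_simps)
      also have "\<dots> = q * s" by (simp add: q_def mult_ac)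
      finally have sr: "s * (1 - q) \<le> r" by (simp add: algebra_simps)
      have "0 \<le> s" by (simp add: s_def)
      \<comment> \<open>For \<open>0 \<le> q < 1 / 2\<close> the inverse of \<open>1 - q\<close> is
        at most \<open>1 + 2 * q\<close>, and this is at most \<open>exp (2 * q)\<close>.\<close>
      have "s \<le> s * ((1 + 2 * q) * (1 - q))"
      proof -
        have "0 \<le> q * (1 - 2 * q)" using q q0 by simp
        then have "1 \<le> (1 + 2 * q) * (1 - q)" by (simp add: algebra_simps)
        from mult_left_mono[OF this \<open>0 \<le> s\<close>] show ?thesis by simp
      qed
      also have "\<dots> = (1 + 2 * q) * (s * (1 - q))" by simp
      also have "\<dots> \<le> exp (2 * q) * r"
        using sr q0 q \<open>0 \<le> s\<close> exp_ge_add_one_self[of "2 * q"] by (intro mult_mono) auto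
      finally show ?thesis by (simp add: s_def r_def)
    qed
    have "\<bar>det (X (grid h (Suc n)))\<bar> \<le> exp (2 * q) ^ CARD('n) * \<bar>det (T ** X (grid h n))\<bar>"
      by (rule abs_det_mono_power[OF le])
        (simp add: T_def step invertible_mult X_invertible grid_nonneg)
    also have "exp (2 * q) ^ CARD('n) = exp (2 * q * d)"
      by (simp add: d_def exp_of_nat_mult[symmetric] mult_ac)
    also have "2 * q * d = (2 * E * e n * d) * h (Suc n)" by (simp add: q_def)
    finally have "\<bar>det (X (grid h (Suc n)))\<bar> \<le> exp ((2 * E * e n * d) * h (Suc n)) * (\<bar>det T\<bar> * \<bar>det (X (grid h n))\<bar>)"
      by (simp add: det_mul abs_mult)
    also have "\<dots> \<le> exp (\<eta> * h (Suc n)) * (\<bar>det T\<bar> * \<bar>det (X (grid h n))\<bar>)"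
      using N[OF n] h(1)[of n] by (intro mult_right_mono) auto
    finally have "\<bar>det (X (grid h (Suc n)))\<bar> \<le> exp (\<eta> * h (Suc n)) * (\<bar>det T\<bar> * \<bar>det (X (grid h n))\<bar>)" .
    from mult_right_mono[OF this, of "\<bar>det (Y n)\<bar>"] show ?thesis
      by (simp add: T_def det_mul abs_mult mult_ac)
  qed
  \<comment> \<open>Chosen to give equality at \<open>n = N\<close>.\<close>
  define C where "C = \<bar>det (X (grid h N))\<bar> / \<bar>det (Y N)\<bar> / exp (\<eta> * grid h N)"
  have detY: "0 < \<bar>det (Y n)\<bar>" for n
    using invertible_step_product[OF step] by (simp add: invertible_det_nz)
  have "0 < C" using detY X_invertible[OF grid_nonneg] by (simp add: C_def invertible_det_nz)
  moreover have "\<bar>det (X (grid h n))\<bar> \<le> C * exp (\<eta> * grid h n) * \<bar>det (Y n)\<bar>" if "N \<le> n" for n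
    using that
  proof (induction n rule: dec_induct)
    case base
    then show ?case using detY[of N] by (simp add: C_def)
  next
    case (step n)
    have "\<bar>det (X (grid h (Suc n)))\<bar> * \<bar>det (Y n)\<bar>
        \<le> exp (\<eta> * h (Suc n)) * \<bar>det (Y (Suc n))\<bar> * \<bar>det (X (grid h n))\<bar>"
      using stepdet[OF step.hyps(1)] by (simp only: mult_ac)
    also have "\<dots> \<le> exp (\<eta> * h (Suc n)) * \<bar>det (Y (Suc n))\<bar> * (C * exp (\<eta> * grid h n) * \<bar>det (Y n)\<bar>)"
      by (rule mult_left_mono[OF step.IH]) simp
    also have "\<dots> = (C * exp (\<eta> * grid h (Suc n)) * \<bar>det (Y (Suc n))\<bar>) * \<bar>det (Y n)\<bar>"
      by (simp add: grid_simps distrib_left exp_add)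
    finally show ?case using detY[of n] by (simp only: mult_le_cancel_right_pos)
  qed
  then have "\<forall>\<^sub>F n in sequentially. \<bar>det (X (grid h n))\<bar> \<le> C * exp (\<eta> * grid h n) * \<bar>det (Y n)\<bar>"
    by (auto simp: eventually_sequentially)
  ultimately show thesis by (rule that)
qed

text \<open>From step \<open>N\<close> on, the increment of \<open>M\<close>, seen at the end of a
  step, is exactly the local error of that step, so \<open>err\<close> supplies the hypothesis on
  increments. Agreement of \<open>Z\<close> with the numerical products at late grid times suffices
  for exponents.\<close>

lemma steps_of_perturbed_system:
  assumes \<delta>: "0 < \<delta>"
  obtains Q Z N where "continuous_on {0..} Q" "\<And>s. 0 \<le> s \<Longrightarrow> opnorm (Q s) \<le> \<delta>"
    "fundamental_matrix (\<lambda>s. A s + Q s) Z" "\<And>n. N \<le> n \<Longrightarrow> Z (grid h n) = Y n"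
proof -
  define E where "E = exp (K * hmax)"
  have hmax: "0 < hmax" using h[of 0] by simp
  \<comment> \<open>\<open>\<delta> / 4\<close> offsets the factor 4 in the perturbation bound, and
    \<open>1 / (2 * hmax)\<close> keeps the relative increment of a step at most 1/2.\<close>
  define \<eta> where "\<eta> = min (\<delta> / 4) (1 / (2 * hmax))"
  have \<eta>: "0 < \<eta>" "4 * \<eta> \<le> \<delta>" "\<eta> * hmax \<le> 1 / 2"
  proof -
    have "\<eta> * hmax \<le> 1 / (2 * hmax) * hmax" unfolding \<eta>_def using hmax by (intro mult_right_mono) auto
    then show "\<eta> * hmax \<le> 1 / 2" using hmax by simp
  qed (use \<delta> hmax in \<open>auto simp: \<eta>_def\<close>)
  \<comment> \<open>One factor \<open>E\<close> carries the error back from the end of the step to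
    \<open>s\<close>, the other compares the start of the step with \<open>s\<close>.\<close>
  have "(\<lambda>n. E * (e n * E)) \<longlonglongrightarrow> 0"
    using e(1) by (auto intro!: tendsto_eq_intros)
  then have "\<forall>\<^sub>F n in sequentially. E * (e n * E) < \<eta>"
    using \<eta> by (intro order_tendstoD(2)) auto
  then obtain N where N: "\<And>n. N \<le> n \<Longrightarrow> E * (e n * E) < \<eta>" by (auto simp: eventually_sequentially)
  \<comment> \<open>The steps before \<open>N\<close> are replaced by exact ones, so there the perturbation vanishes.\<close>
  define M where "M n = matrix_inv (X (grid h (max n N))) ** Y (max n N)" for n
  have XM: "X (grid h (max n N)) ** M n = Y (max n N)" for n
    using matrix_inv_mult(1)[OF X_invertible[OF grid_nonneg]] by (simp add: M_def matrix_mul_assoc)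
  have M: "invertible (M n)" for n
  proof -
    have "det (X (grid h (max n N))) * det (M n) = det (Y (max n N))" by (metis XM det_mul)
    then show ?thesis
      using invertible_step_product[OF step, of "max n N"] by (auto simp: invertible_det_nz)
  qed
  have incr: "norm (X s *v ((M (Suc n) - M n) *v y)) \<le> \<eta> * (grid h (Suc n) - grid h n) * norm (X s *v (M n *v y))"
    if s: "grid h n \<le> s" "s \<le> grid h (Suc n)" for n s y
  proof (cases "N \<le> n")
    case False
    then have "max (Suc n) N = max n N" by simp
    then have "M (Suc n) = M n" by (simp only: M_def)
    then show ?thesis using \<eta>(1) h(1)[of n] by (simp add: grid_simps)
  next
    case True
    define u where "u = M n *v y"
    define D where "D = (M (Suc n) - M n) *v y"
    have Y: "X (grid h n) *v u = Y n *v y" "X (grid h (Suc n)) *v (M (Suc n) *v y) = Y (Suc n) *v y"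
      using XM[of n] XM[of "Suc n"] True by (simp_all add: u_def matrix_vector_mul_assoc max_def)
    have "X (grid h (Suc n)) *v D = step_matrix \<Phi> h (Suc n) *v (X (grid h n) *v u) - X (grid h (Suc n)) *v u"
      unfolding D_def matrix_vector_mult_diff_rdistrib matrix_vector_mult_diff_distrib Y
      by (simp add: u_def matrix_vector_mul_assoc)
    then have D: "norm (X (grid h (Suc n)) *v D) \<le> e n * h (Suc n) * norm (X (grid h n) *v u)"
      using err[of n u] by simp
    have "norm (X s *v D) \<le> E * norm (X (grid h (Suc n)) *v D)"
      unfolding E_def using s by (intro X_growth[of n]) auto
    also have "\<dots> \<le> E * (e n * h (Suc n) * norm (X (grid h n) *v u))"
      using D by (intro mult_left_mono) (auto simp: E_def)
    also have "\<dots> \<le> E * (e n * h (Suc n) * (E * norm (X s *v u)))"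
      unfolding E_def using s e(2)[of n] h(1)[of n]
      by (intro mult_left_mono X_growth[of n]) (auto intro: mult_nonneg_nonneg less_imp_le)
    also have "\<dots> = (E * (e n * E)) * (h (Suc n) * norm (X s *v u))" by simp
    also have "\<dots> \<le> \<eta> * (h (Suc n) * norm (X s *v u))"
      using N[OF True] h(1)[of n] by (intro mult_right_mono) auto
    finally show ?thesis by (simp add: D_def u_def grid_simps)
  qed
  have "\<eta> * (grid h (Suc n) - grid h n) \<le> 1 / 2" for n
    using order_trans[OF mult_left_mono[OF h(2)[of n], of \<eta>] \<eta>(3)] \<eta>(1) by (simp add: grid_simps)
  with perturbed_fundamental_matrix[OF X strict_mono_grid grid_simps(1) time M incr less_imp_le[OF \<eta>(1)]]
  obtain Q Z where QZ: "continuous_on {0..} Q" "\<And>s. 0 \<le> s \<Longrightarrow> opnorm (Q s) \<le> 4 * \<eta>"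
    "fundamental_matrix (\<lambda>s. A s + Q s) Z" "\<And>n. Z (grid h n) = X (grid h n) ** M n" by blast
  show thesis
  proof (rule that[OF QZ(1) _ QZ(3)])
    show "opnorm (Q s) \<le> \<delta>" if "0 \<le> s" for s using QZ(2)[OF that] \<eta>(2) by simp
    show "Z (grid h n) = Y n" if "N \<le> n" for n
      using QZ(4)[of n] XM[of n] that by (simp add: max_def)
  qed
qed

text \<open>Stability keeps the exponent of the perturbed system within \<open>\<epsilon>\<close> of
  \<open>l\<close>; the dimension count is applied to that system, whose fundamental matrix agrees
  with \<open>Y\<close> at late grid times.\<close>

lemma slow_subspace:
  assumes stable: "stable_exponents A" and L: "Lyap A i = ereal l" and \<epsilon>: "0 < \<epsilon>"
  obtains U where "subspace U" "CARD('n) \<le> dim U + card {j. j < i}"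
    "\<And>c b. c \<in> U \<Longrightarrow> l + \<epsilon> < b \<Longrightarrow> \<forall>\<^sub>F n in sequentially. norm (Y n *v c) \<le> exp (b * grid h n)"
proof -
  obtain \<delta> :: real where \<delta>: "0 < \<delta>"
    and st: "\<And>Q :: real \<Rightarrow> 'n sqmat. continuous_on {0..} Q \<Longrightarrow> (SUP t\<in>{0..}. ereal (opnorm (Q t))) < ereal \<delta> \<Longrightarrow>
      \<bar>Lyap A i - Lyap (\<lambda>t. A t + Q t) i\<bar> < ereal \<epsilon>"
    using stable \<epsilon> unfolding stable_exponents_def by blast
  \<comment> \<open>Half of \<open>\<delta>\<close> is used because the supremum must be strictly
    below \<open>\<delta>\<close>.\<close>
  obtain Q Z N where Q: "continuous_on {0..} Q" "\<And>s. 0 \<le> s \<Longrightarrow> opnorm (Q s) \<le> \<delta> / 2"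
    and Z: "fundamental_matrix (\<lambda>s. A s + Q s) Z" and ZY: "\<And>n. N \<le> n \<Longrightarrow> Z (grid h n) = Y n"
    using steps_of_perturbed_system[OF half_gt_zero[OF \<delta>]] by blast
  have "(SUP t\<in>{0..}. ereal (opnorm (Q t))) \<le> ereal (\<delta> / 2)"
    using Q(2) by (intro SUP_least) auto
  also have "\<dots> < ereal \<delta>" using \<delta> by simp
  finally have "\<bar>Lyap A i - Lyap (\<lambda>t. A t + Q t) i\<bar> < ereal \<epsilon>" using st[OF Q(1)] by blast
  then have near: "Lyap (\<lambda>t. A t + Q t) i \<le> ereal (l + \<epsilon>)"
    unfolding L by (cases "Lyap (\<lambda>t. A t + Q t) i") auto
  define U where "U = {c. lyap_exp (sol_of Z c) \<le> Lyap (\<lambda>t. A t + Q t) i}"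
  have "opnorm (A t + Q t) \<le> K + \<delta> / 2" if "0 \<le> t" for t
  proof (rule opnorm_le)
    fix x
    have "norm ((A t + Q t) *v x) \<le> norm (A t *v x) + norm (Q t *v x)"
      by (simp add: matrix_vector_mult_add_rdistrib norm_triangle_ineq)
    also have "\<dots> \<le> K * norm x + \<delta> / 2 * norm x"
      using K(1)[OF that] Q(2)[OF that]
      by (intro add_mono order_trans[OF norm_le_opnorm] mult_right_mono) auto
    finally show "norm ((A t + Q t) *v x) \<le> (K + \<delta> / 2) * norm x" by (simp add: algebra_simps)
  qed
  from dim_lyap_le_Lyap[OF Z this, of i] have dim: "CARD('n) \<le> dim U + card {j. j < i}"
    by (simp add: U_def)
  show thesis
  proof (rule that[OF _ dim])
    show "subspace U" unfolding U_def by (rule subspace_lyap_le)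
    fix c b assume "c \<in> U" "l + \<epsilon> < b"
    with near have "lyap_exp (sol_of Z c) \<le> ereal (l + \<epsilon>)" "ereal (l + \<epsilon>) < ereal b"
      by (auto simp: U_def intro: order_trans)
    then have "\<forall>\<^sub>F t in at_top. norm (Z t *v c) \<le> exp (b * t)"
      unfolding lyap_exp_sol_le_iff by blast
    then have "\<forall>\<^sub>F n in sequentially. norm (Z (grid h n) *v c) \<le> exp (b * grid h n)"
      by (rule eventually_compose_filterlim[OF _ time])
    then show "\<forall>\<^sub>F n in sequentially. norm (Y n *v c) \<le> exp (b * grid h n)"
      using eventually_ge_at_top[of N] by eventually_elim (simp add: ZY)
  qed
qed

text \<open>The gap between \<open>b\<close> and a slightly larger rate \<open>b'\<close> is split
  into two halves \<open>\<eta>\<close>: one pays for the loss in \<open>det_lower_bound\<close>,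
  the other absorbs the constant \<open>C / c\<close>.\<close>

lemma det_growth:
  assumes regular: "ereal b < Liminf at_top (\<lambda>t. ereal (1 / t) * elog \<bar>det (X t)\<bar>)" and c: "0 < c"
  shows "\<forall>\<^sub>F n in sequentially. exp (b * grid h n) \<le> \<bar>det (Y n)\<bar> * c"
proof -
  obtain b' where b': "b < b'" "ereal b' < Liminf at_top (\<lambda>t. ereal (1 / t) * elog \<bar>det (X t)\<bar>)"
    using ereal_dense2[OF regular] by auto
  define \<eta> where "\<eta> = (b' - b) / 2"
  have \<eta>: "0 < \<eta>" using b' by (simp add: \<eta>_def)
  obtain C where C: "0 < C"
    "\<forall>\<^sub>F n in sequentially. \<bar>det (X (grid h n))\<bar> \<le> C * exp (\<eta> * grid h n) * \<bar>det (Y n)\<bar>"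
    using det_lower_bound[OF \<eta>] by blast
  have "\<forall>\<^sub>F t in at_top. ereal b' < ereal (1 / t) * elog \<bar>det (X t)\<bar>"
    by (rule less_LiminfD[OF b'(2)])
  then have "\<forall>\<^sub>F t in at_top. exp (b' * t) \<le> \<bar>det (X t)\<bar>"
    using eventually_gt_at_top[of 0] by eventually_elim (simp add: less_scaled_elog_iff)
  then have "\<forall>\<^sub>F n in sequentially. exp (b' * grid h n) \<le> \<bar>det (X (grid h n))\<bar>"
    by (rule eventually_compose_filterlim[OF _ time])
  moreover have "\<forall>\<^sub>F n in sequentially. C / c \<le> exp (\<eta> * grid h n)"
  proof -
    have "filterlim (\<lambda>n. exp (\<eta> * grid h n)) at_top sequentially"
      by (rule filterlim_compose[OF exp_at_top])
        (rule filterlim_tendsto_pos_mult_at_top[OF tendsto_const \<eta> time])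
    then show ?thesis by (simp add: filterlim_at_top)
  qed
  ultimately show ?thesis using C(2)
  proof eventually_elim
    case (elim n)
    define g where "g = exp (\<eta> * grid h n)"
    have "exp (b * grid h n) * (g * g) = exp (b' * grid h n)"
      by (simp add: g_def mult_exp_exp \<eta>_def field_simps)
    then have "exp (b * grid h n) * g * g \<le> (C * \<bar>det (Y n)\<bar>) * g"
      using elim by (simp add: g_def mult_ac)
    then have 1: "exp (b * grid h n) * g \<le> C * \<bar>det (Y n)\<bar>" by (simp add: g_def)
    have "exp (b * grid h n) * C = exp (b * grid h n) * (C / c) * c" using c by simp
    also have "\<dots> \<le> exp (b * grid h n) * g * c"
      using elim c by (intro mult_right_mono mult_left_mono) (auto simp: g_def)
    also have "\<dots> \<le> C * \<bar>det (Y n)\<bar> * c" using 1 c by (intro mult_right_mono) auto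
    finally have "C * exp (b * grid h n) \<le> C * (\<bar>det (Y n)\<bar> * c)" by (simp add: mult_ac)
    then show ?case using C(1) by simp
  qed
qed

end

section \<open>Convergence from one-sided bounds\<close>

lemma tendsto_of_sum_lower_bound:
  fixes \<mu> :: "'i::finite \<Rightarrow> nat \<Rightarrow> real"
  assumes upper: "\<And>i b. L i < b \<Longrightarrow> \<forall>\<^sub>F n in sequentially. \<mu> i n \<le> b"
    and lower: "\<And>b. b < (\<Sum>i\<in>UNIV. L i) \<Longrightarrow> \<forall>\<^sub>F n in sequentially. b \<le> (\<Sum>i\<in>UNIV. \<mu> i n)"
  shows "\<mu> i \<longlonglongrightarrow> L i"
proof (rule tendstoI)
  fix e :: real assume e: "0 < e"
  define d where "d = real CARD('i)"
  have d: "0 < d" by (simp add: d_def)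
  have "\<forall>\<^sub>F n in sequentially. \<forall>j\<in>UNIV. \<mu> j n \<le> L j + e / (4 * d)"
    using upper e d by (intro eventually_ball_finite) auto
  moreover have "\<forall>\<^sub>F n in sequentially. (\<Sum>i\<in>UNIV. L i) - e / 4 \<le> (\<Sum>i\<in>UNIV. \<mu> i n)"
    using lower e by simp
  ultimately show "\<forall>\<^sub>F n in sequentially. dist (\<mu> i n) (L i) < e"
  proof eventually_elim
    case (elim n)
    \<comment> \<open>Each of the other terms exceeds its \<open>L j\<close> by at most
      \<open>e / (4 * d)\<close>, together by at most \<open>e / 4\<close>; subtracting them from
      the sum bounds \<open>\<mu> i n\<close> from below.\<close>
    have "(\<Sum>j\<in>UNIV - {i}. \<mu> j n) \<le> (\<Sum>j\<in>UNIV - {i}. L j + e / (4 * d))"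
      using elim by (intro sum_mono) auto
    also have "\<dots> = (\<Sum>j\<in>UNIV - {i}. L j) + real (card (UNIV - {i})) * (e / (4 * d))"
      by (simp add: sum.distrib)
    also have "real (card (UNIV - {i})) * (e / (4 * d)) \<le> d * (e / (4 * d))"
      using e d by (intro mult_right_mono) (auto simp: d_def card_Diff_subset)
    also have "\<dots> = e / 4" using d by simp
    finally have "(\<Sum>j\<in>UNIV - {i}. \<mu> j n) \<le> (\<Sum>j\<in>UNIV - {i}. L j) + e / 4" by simp
    moreover have "(\<Sum>j\<in>UNIV. \<mu> j n) = \<mu> i n + (\<Sum>j\<in>UNIV - {i}. \<mu> j n)"
      "(\<Sum>j\<in>UNIV. L j) = L i + (\<Sum>j\<in>UNIV - {i}. L j)" by (simp_all add: sum.remove[of UNIV i])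
    ultimately have "L i - e / 2 \<le> \<mu> i n" using elim by simp
    moreover have "1 \<le> d" by (simp add: d_def Suc_le_eq)
    then have "e / (4 * d) \<le> e / 4" using e by (intro divide_left_mono) auto
    then have "\<mu> i n \<le> L i + e / 4" using elim by (meson UNIV_I add_left_mono order_trans)
    ultimately show ?case using e by (simp add: dist_real_def abs_less_iff)
  qed
qed

text \<open>Boundedness of \<open>A\<close> refers to the Frobenius norm, the growth estimates to
  the operator norm; boundedness of the bilinear product links the two.\<close>

lemma opnorm_le_norm: obtains C where "\<And>M :: ('n::finite) sqmat. opnorm M \<le> C * norm M"
proof -
  have "bilinear ((*v) :: 'n sqmat \<Rightarrow> real^'n \<Rightarrow> _)"
    unfolding bilinear_def
    by (auto simp: bounded_linear.linear[OF bounded_linear_matrix_vector_left])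
  then obtain C where "\<And>(M :: 'n sqmat) x. norm (M *v x) \<le> C * norm M * norm x"
    using bilinear_bounded by blast
  then show thesis by (intro that opnorm_le)
qed

text \<open>One power of \<open>h (Suc n)\<close> in the consistency bound is kept apart; the rest
  is \<open>e n\<close>, which tends to 0 with the stepsizes since \<open>0 < p\<close>. Testing on
  vectors \<open>X (grid h n) *v y\<close> cancels the inverse in the Cauchy matrix.\<close>

lemma local_error:
  fixes X :: "real \<Rightarrow> ('n::finite) sqmat"
  assumes X: "fundamental_matrix A X" and p: "0 < p" and cons: "consistent X hmax \<Phi> p"
    and steps: "\<And>n. 1 \<le> n \<Longrightarrow> 0 < h n \<and> h n \<le> hmax" and h0: "h \<longlonglongrightarrow> 0"
  obtains e where "e \<longlonglongrightarrow> 0" "\<And>n. 0 \<le> (e n :: real)"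
    "\<And>n y. norm (step_matrix \<Phi> h (Suc n) *v (X (grid h n) *v y) - X (grid h (Suc n)) *v y)
        \<le> e n * h (Suc n) * norm (X (grid h n) *v y)"
proof -
  obtain c where c: "0 < c" and err: "\<And>t s. 0 \<le> t \<Longrightarrow> s \<in> {0..hmax} \<Longrightarrow>
      opnorm (\<Phi> t s - cauchy_matrix X (t + s) t) \<le> c * s powr (p + 1)"
    using cons unfolding consistent_def by blast
  define e where "e n = c * h (Suc n) powr p" for n
  have pos: "0 < h (Suc n)" "h (Suc n) \<le> hmax" for n using steps[of "Suc n"] by auto
  have "(\<lambda>n. h (Suc n) powr p) \<longlonglongrightarrow> 0"
    using pos p by (intro tendsto_zero_powrI[OF LIMSEQ_Suc[OF h0] tendsto_const])
      (auto intro: less_imp_le always_eventually)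
  then have "e \<longlonglongrightarrow> 0" unfolding e_def by (rule tendsto_mult_right_zero)
  moreover have "0 \<le> e n" for n using c by (simp add: e_def)
  moreover have "norm (step_matrix \<Phi> h (Suc n) *v (X (grid h n) *v y) - X (grid h (Suc n)) *v y)
        \<le> e n * h (Suc n) * norm (X (grid h n) *v y)" for n y
  proof -
    have t: "0 \<le> grid h n" unfolding grid_def using steps by (intro sum_nonneg) (auto intro: less_imp_le)
    let ?D = "step_matrix \<Phi> h (Suc n) - cauchy_matrix X (grid h (Suc n)) (grid h n)"
    have "invertible (X (grid h n))" using X t by (auto simp: fundamental_matrix_def)
    then have "cauchy_matrix X (grid h (Suc n)) (grid h n) *v (X (grid h n) *v y) = X (grid h (Suc n)) *v y"
      by (simp add: cauchy_matrix_def matrix_vector_mul_assoc matrix_mul_assoc[symmetric] matrix_inv_mult)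
    then have "norm (step_matrix \<Phi> h (Suc n) *v (X (grid h n) *v y) - X (grid h (Suc n)) *v y)
        = norm (?D *v (X (grid h n) *v y))"
      by (simp add: matrix_vector_mult_diff_rdistrib)
    also have "\<dots> \<le> opnorm ?D * norm (X (grid h n) *v y)" by (rule norm_le_opnorm)
    also have "opnorm ?D \<le> c * h (Suc n) powr (p + 1)"
      using err[OF t, of "h (Suc n)"] pos[of n] by (simp add: step_matrix_def grid_def)
    also have "\<dots> = e n * h (Suc n)" using pos[of n] by (simp add: e_def powr_add)
    finally show ?thesis by (simp add: mult_right_mono)
  qed
  ultimately show thesis by (rule that)
qed

text \<open>Stability applies to the zero perturbation, and in \<open>ereal\<close> an infinite
  value minus itself is \<infinity>, which is not below 1.\<close>

lemma stable_exponents_finite: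
  assumes "stable_exponents A"
  shows "\<bar>Lyap A i\<bar> \<noteq> \<infinity>"
proof -
  obtain \<delta> :: real where \<delta>: "0 < \<delta>" and st: "\<And>Q :: real \<Rightarrow> _ sqmat. continuous_on {0..} Q \<Longrightarrow>
      (SUP t\<in>{0..}. ereal (opnorm (Q t))) < ereal \<delta> \<Longrightarrow> \<bar>Lyap A i - Lyap (\<lambda>t. A t + Q t) i\<bar> < ereal 1"
    using assms zero_less_one unfolding stable_exponents_def by blast
  have "opnorm (0 :: 'a sqmat) \<le> 0" by (rule opnorm_le) simp
  then have "(SUP t\<in>{0::real..}. ereal (opnorm (0 :: 'a sqmat))) \<le> ereal 0"
    by (intro SUP_least) simp
  then have "\<bar>Lyap A i - Lyap (\<lambda>t. A t + 0) i\<bar> < ereal 1"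
    using \<delta> by (intro st) (auto intro: le_less_trans)
  then show ?thesis by (cases "Lyap A i") auto
qed

theorem theorem4p6:
  fixes A X :: "real \<Rightarrow> ('n::{finite,linorder}) sqmat"
    and \<Phi> :: "real \<Rightarrow> real \<Rightarrow> 'n sqmat"
    and hmax p :: real
    and h :: "nat \<Rightarrow> real"
  assumes bounded: "bounded (A ` {0..})"
    and lipschitz: "\<exists>L. L-lipschitz_on {0..} A"
    and fundamental: "fundamental_matrix A X"
    and regular: "regular_system A X"
    and stable: "stable_exponents A"
    and hmax: "0 < hmax"
    and one_step: "one_step_method hmax \<Phi>"
    and order: "0 < p"
    and consistent: "consistent X hmax \<Phi> p"
    and steps: "\<And>n. 1 \<le> n \<Longrightarrow> 0 < h n \<and> h n \<le> hmax"
    and time: "filterlim (grid h) at_top sequentially"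
    and steps_to_0: "h \<longlonglongrightarrow> 0"
  shows "AE v in lebesgue. \<forall>i. (\<lambda>n. ereal (benettin_output \<Phi> h v i n)) \<longlonglongrightarrow> Lyap A i"
proof -
  let ?Y = "step_product \<Phi> h"
  obtain C where C: "\<And>M :: 'n sqmat. opnorm M \<le> C * norm M" using opnorm_le_norm by blast
  obtain a where a: "\<And>t. 0 \<le> t \<Longrightarrow> norm (A t) \<le> a"
    using bounded by (auto simp: bounded_iff)
  define K where "K = \<bar>C\<bar> * \<bar>a\<bar>"
  have K: "opnorm (A t) \<le> K" if "0 \<le> t" for t
  proof -
    have "C * norm (A t) \<le> \<bar>C\<bar> * \<bar>a\<bar>" using a[OF that] by (intro mult_mono) auto
    then show ?thesis using C[of "A t"] by (simp add: K_def)
  qed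
  have K0: "0 \<le> K" by (simp add: K_def)
  have h: "0 < h (Suc n)" "h (Suc n) \<le> hmax" for n using steps[of "Suc n"] by auto
  have grid0: "0 \<le> grid h n" for n
    unfolding grid_def using steps by (intro sum_nonneg) (auto intro: less_imp_le)
  have step: "invertible (step_matrix \<Phi> h (Suc n))" for n
    using one_step h[of n] grid0[of n] by (simp add: one_step_method_def step_matrix_def)
  obtain e where e: "e \<longlonglongrightarrow> 0" "\<And>n. 0 \<le> (e n :: real)"
    and err: "\<And>n y. norm (step_matrix \<Phi> h (Suc n) *v (X (grid h n) *v y) - X (grid h (Suc n)) *v y)
        \<le> e n * h (Suc n) * norm (X (grid h n) *v y)"
    using local_error[OF fundamental order consistent steps steps_to_0] by blast
  note system = fundamental K K0 step h time e err
  define l where "l i = real_of_ereal (Lyap A i)" for i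
  have l: "Lyap A i = ereal (l i)" for i
    using stable_exponents_finite[OF stable, of i] by (simp add: l_def ereal_real')
  have sum_l: "Liminf at_top (\<lambda>t. ereal (1 / t) * elog \<bar>det (X t)\<bar>) = ereal (\<Sum>i\<in>UNIV. l i)"
    using regular by (simp add: regular_system_def l)
  \<comment> \<open>Stability yields one subspace for each tolerance. The tolerances
    \<open>1 / real (Suc m)\<close> leave only countably many exceptional null sets.\<close>
  let ?slow = "\<lambda>v i m. \<exists>x. x $ i = 1 \<and> (\<forall>j>i. x $ j = 0) \<and> (\<forall>b > l i + 1 / real (Suc m).
      \<forall>\<^sub>F n in sequentially. norm (?Y n *v (transpose v *v x)) \<le> exp (b * grid h n))"
  have "AE v in lebesgue. ?slow v i m" for i m
  proof -
    obtain U where U: "subspace U" "CARD('n) \<le> dim U + card {j. j < i}"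
      and slow: "\<And>c b. c \<in> U \<Longrightarrow> l i + 1 / real (Suc m) < b \<Longrightarrow>
        \<forall>\<^sub>F n in sequentially. norm (?Y n *v c) \<le> exp (b * grid h n)"
      using slow_subspace[OF system stable l, of "1 / real (Suc m)" i] by (auto simp del: of_nat_Suc)
    show ?thesis using AE_reduce_into_subspace[OF U] by (rule AE_mp[OF _ AE_I2]) (use slow in blast)
  qed
  then have "AE v in lebesgue. \<forall>i\<in>UNIV. \<forall>m\<in>UNIV. ?slow v i m"
    by (simp only: AE_ball_countable countable_finite finite countableI_type) simp
  \<comment> \<open>With every row generic, no fixed rows remain and their independence holds
    vacuously.\<close>
  moreover have "AE v :: 'n sqmat in lebesgue. invertible v"
    using AE_rows_invertible[where K = UNIV] by simp
  ultimately show ?thesis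
  proof eventually_elim
    case (elim v)
    have pos: "\<forall>\<^sub>F n in sequentially. 1 \<le> n \<and> 0 < grid h n"
      using eventually_ge_at_top[of "1::nat"] filterlim_at_top_dense[THEN iffD1, OF time, rule_format, of 0]
      by eventually_elim simp
    have "(\<lambda>n. benettin_output \<Phi> h v i n) \<longlonglongrightarrow> l i" for i
    proof (rule tendsto_of_sum_lower_bound)
      fix i b assume "l i < b"
      then obtain m where m: "l i + 1 / real (Suc m) < b"
        using reals_Archimedean[of "b - l i"] by (auto simp: inverse_eq_divide algebra_simps)
      from elim(1) have "?slow v i m" by simp
      then obtain x where x: "x $ i = 1" "\<forall>j>i. x $ j = 0"
        and slow: "\<forall>\<^sub>F n in sequentially. norm (?Y n *v (transpose v *v x)) \<le> exp (b * grid h n)"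
        using m by blast
      from slow show "\<forall>\<^sub>F n in sequentially. benettin_output \<Phi> h v i n \<le> b"
        using pos
      proof eventually_elim
        case (elim n)
        have "exp (grid h n * benettin_output \<Phi> h v i n) \<le> norm (?Y n *v (transpose v *v x))"
          by (rule benettin_output_bounds(1)[OF step \<open>invertible v\<close> _ _ x]) (use elim in auto)
        also have "\<dots> \<le> exp (b * grid h n)" by (rule elim(1))
        finally show ?case using elim(2) by simp
      qed
    next
      fix b assume "b < (\<Sum>i\<in>UNIV. l i)"
      then have "ereal b < Liminf at_top (\<lambda>t. ereal (1 / t) * elog \<bar>det (X t)\<bar>)" by (simp add: sum_l)
      moreover have "0 < \<bar>det v\<bar>" using elim by (simp add: invertible_det_nz)
      ultimately have "\<forall>\<^sub>F n in sequentially. exp (b * grid h n) \<le> \<bar>det (?Y n)\<bar> * \<bar>det v\<bar>"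
        using det_growth[OF system, of b "\<bar>det v\<bar>"] by blast
      then show "\<forall>\<^sub>F n in sequentially. b \<le> (\<Sum>i\<in>UNIV. benettin_output \<Phi> h v i n)"
        using pos
      proof eventually_elim
        case (elim n)
        then have "exp (b * grid h n) \<le> exp (grid h n * (\<Sum>i\<in>UNIV. benettin_output \<Phi> h v i n))"
          using benettin_output_bounds(2)[OF step \<open>invertible v\<close>, of n] by simp
        then show ?case using elim by simp
      qed
    qed
    then show ?case by (simp add: l)
  qed
qed

end
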